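(* Let $(K,v)$ be a valued field, $\overline{K}$ an algebraic closure of $K$, $\overline{v}$ an extension of $v$ to $\overline{K}$, and $X$ transcendental over $K$. Let $a,b\in\overline{K}$ and let $\gamma$ be an element of some ordered abelian group containing $\overline{v}\overline{K}$. Then the following are equivalent: (i) $\overline{v}_{a,\gamma}|_{K(X)}=\overline{v}_{b,\gamma}|_{K(X)}$; (ii) $\overline{v}_{a,\gamma}=\overline{v}_{\sigma b,\gamma}$ for some $\sigma\in G^d$.
   Context: Valuations are written additively. For $a\in\overline{K}$ and $\gamma$ in an ordered abelian group containing $\overline{v}\overline{K}$, $\overline{v}_{a,\gamma}$ is the valuation on $\overline{K}(X)$ with $\overline{v}_{a,\gamma}\left(\sum_i c_i(X-a)^i\right)=\min_i\{\overline{v}c_i+i\gamma\}$ for $c_i\in\overline{K}$; equivalently it extends $\overline{v}$ and $\overline{v}_{a,\gamma}(X-z)=\min\{\gamma,\overline{v}(a-z)\}$ for all $z\in\overline{K}$. $G:=\mathrm{Gal}(\overline{K}|K)$ is the group of automorphisms of $\overline{K}$ over $K$, and $G^d:=\{\sigma\in G\mid \overline{v}(\sigma c)=\overline{v}(c)\text{ for all }c\in\overline{K}\}$ is the absolute decomposition group. *)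

theory Defs
  imports
    "HOL-Computational_Algebra.Computational_Algebra"
    "Subresultants.More_Homomorphisms"
    "HOL-Library.FuncSet"
begin

hide_const (open) Module.smult  (* smult is the scalar multiplication of polynomials *)

section \<open>Ordered abelian groups with infinity\<close>

datatype 'g with_infty = Val 'g | Infty

instantiation with_infty :: (linorder) linorder
begin

fun less_eq_with_infty :: "'a with_infty \<Rightarrow> 'a with_infty \<Rightarrow> bool" where
  "less_eq_with_infty x Infty \<longleftrightarrow> True"
| "less_eq_with_infty (Val x) (Val y) \<longleftrightarrow> x \<le> y"
| "less_eq_with_infty Infty (Val y) \<longleftrightarrow> False"

definition less_with_infty :: "'a with_infty \<Rightarrow> 'a with_infty \<Rightarrow> bool" where
  "less_with_infty x y \<longleftrightarrow> x \<le> y \<and> \<not> y \<le> x"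

instance
proof
  fix x y z :: "'a with_infty"
  show "x < y \<longleftrightarrow> x \<le> y \<and> \<not> y \<le> x"
    by (rule less_with_infty_def)
  show "x \<le> x"
    by (cases x) auto
  show "x \<le> z" if "x \<le> y" "y \<le> z"
    using that by (cases x; cases y; cases z) auto
  show "x = y" if "x \<le> y" "y \<le> x"
    using that by (cases x; cases y) auto
  show "x \<le> y \<or> y \<le> x"
    by (cases x; cases y) auto
qed

end

lemma less_with_infty_simps [simp]:
  "Val x < Val y \<longleftrightarrow> x < y"
  "Val x < Infty"
  "\<not> Infty < z"
  by (auto simp: less_with_infty_def)

instantiation with_infty :: (linordered_ab_group_add) ordered_comm_monoid_add
begin

definition zero_with_infty :: "'a with_infty" where
  "0 = Val 0"

fun plus_with_infty :: "'a with_infty \<Rightarrow> 'a with_infty \<Rightarrow> 'a with_infty" where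
  "plus_with_infty (Val x) (Val y) = Val (x + y)"
| "plus_with_infty Infty y = Infty"
| "plus_with_infty x Infty = Infty"

instance
proof
  fix x y z :: "'a with_infty"
  show "x + y + z = x + (y + z)"
    by (cases x; cases y; cases z) (auto simp: algebra_simps)
  show "x + y = y + x"
    by (cases x; cases y) (auto simp: algebra_simps)
  show "0 + x = x"
    by (cases x) (auto simp: zero_with_infty_def)
  show "z + x \<le> z + y" if "x \<le> y"
    using that by (cases x; cases y; cases z) auto
qed

end

lemma plus_Infty_right [simp]: "x + Infty = (Infty :: 'g::linordered_ab_group_add with_infty)"
  by (cases x) auto

lemma with_infty_add_less_le:
  fixes x y x' y' :: "'g::linordered_ab_group_add with_infty"
  assumes "x < x'" "y \<le> y'" "y \<noteq> Infty"
  shows "x + y < x' + y'"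
  using assms by (cases x; cases y; cases x'; cases y') (auto simp: add_less_le_mono)

lemma with_infty_add_left_cancel:
  fixes x y z :: "'g::linordered_ab_group_add with_infty"
  assumes "z \<noteq> Infty"
  shows "x + z = y + z \<longleftrightarrow> x = y" "x + z \<le> y + z \<longleftrightarrow> x \<le> y"
  using assms by (cases x; cases y; cases z; simp)+


section \<open>Valuations\<close>

text \<open>
  A valuation need not be onto the group \<^typ>\<open>'g\<close>: its value group is a subgroup, so that
  \<^typ>\<open>'g\<close> plays the role of any ordered abelian group containing the value group.
\<close>

definition valuation :: "('a::field \<Rightarrow> 'g::linordered_ab_group_add with_infty) \<Rightarrow> bool" where
  "valuation v \<longleftrightarrow>
     (\<forall>x. v x = Infty \<longleftrightarrow> x = 0) \<and>
     (\<forall>x y. v (x * y) = v x + v y) \<and>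
     (\<forall>x y. min (v x) (v y) \<le> v (x + y))"

definition nat_scale :: "nat \<Rightarrow> 'g::linordered_ab_group_add \<Rightarrow> 'g" where
  "nat_scale n \<gamma> = (\<Sum>j<n. \<gamma>)"

text \<open>
  The valuation $v_{a,\gamma}$ on the rational function field $L(X)$, the type
  \<^typ>\<open>'l poly fract\<close>.  The polynomial $X - a$ is \<open>[:- a, 1:]\<close>.  If \<open>v\<close> is a valuation,
  exactly one \<open>w\<close> has the defining property: see \<open>ex1_gauss_valuation\<close> below.
\<close>

definition gauss_valuation ::
  "('l::field \<Rightarrow> 'g::linordered_ab_group_add with_infty) \<Rightarrow> 'l \<Rightarrow> 'g \<Rightarrow> 'l poly fract \<Rightarrow> 'g with_infty" where
  "gauss_valuation v a \<gamma> = (THE w. valuation w \<and>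
     (\<forall>c n. w (to_fract (\<Sum>i\<le>n. smult (c i) ([:- a, 1:] ^ i))) =
            (MIN i\<in>{..n}. v (c i) + Val (nat_scale i \<gamma>))))"


section \<open>Galois and decomposition groups\<close>

text \<open>
  A field $K$ and an algebraic closure $L$ of $K$ are two types with an embedding
  $\iota : K \to L$; that $L$ is algebraically closed is its type class.
\<close>

definition algebraic_closure_map :: "('k::field \<Rightarrow> 'l::alg_closed_field) \<Rightarrow> bool" where
  "algebraic_closure_map \<iota> \<longleftrightarrow>
     field_hom \<iota> \<and> (\<forall>x. \<exists>p. p \<noteq> 0 \<and> poly (map_poly \<iota> p) x = 0)"

definition Gal :: "('k::field \<Rightarrow> 'l::field) \<Rightarrow> ('l \<Rightarrow> 'l) set" where
  "Gal \<iota> = {\<sigma>. field_hom \<sigma> \<and> bij \<sigma> \<and> (\<forall>c. \<sigma> (\<iota> c) = \<iota> c)}"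

definition decomposition_group ::
  "('k::field \<Rightarrow> 'l::field) \<Rightarrow> ('l \<Rightarrow> 'g::linordered_ab_group_add with_infty) \<Rightarrow> ('l \<Rightarrow> 'l) set" where
  "decomposition_group \<iota> v = {\<sigma> \<in> Gal \<iota>. \<forall>c. v (\<sigma> c) = v c}"

text \<open>The subfield $K(X)$ of $L(X)$, for an embedding $\iota : K \to L$.\<close>

definition rational_functions_over :: "('k::field \<Rightarrow> 'l::field) \<Rightarrow> 'l poly fract set" where
  "rational_functions_over \<iota> = {Fract (map_poly \<iota> p) (map_poly \<iota> q) | p q. q \<noteq> 0}"


section \<open>Existence and uniqueness of the valuations $v_{a,\gamma}$\<close>

context
  fixes v :: "'l::field \<Rightarrow> 'g::linordered_ab_group_add with_infty"
  assumes val: "valuation v"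
begin

lemma v_eq_Infty: "v x = Infty \<longleftrightarrow> x = 0" 
  and v_mult: "v (x * y) = v x + v y"
  and v_add: "min (v x) (v y) \<le> v (x + y)"
  using val by (auto simp: valuation_def)

lemma v_zero: "v 0 = Infty"
  by (simp add: v_eq_Infty)

lemma v_one: "v 1 = 0"
proof -
  have "v 1 + v 1 = 0 + v 1" using v_mult[of 1 1] by simp
  thus ?thesis using v_eq_Infty[of 1] with_infty_add_left_cancel(1)[of "v 1" "v 1" 0] by simp
qed

lemma v_minus: "v (- x) = v x"
proof -
  have "v (-1) + v (-1) = 0" using v_mult[of "-1" "-1"] v_one by simp
  hence "v (-1) = 0"
    by (cases "v (-1)") (auto simp: zero_with_infty_def)
  thus ?thesis using v_mult[of "-1" x] by simp
qed

lemma v_sum_le: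
  assumes "finite A" "\<And>i. i \<in> A \<Longrightarrow> m \<le> v (f i)"
  shows "m \<le> v (sum f A)"
  using assms
proof (induction A rule: finite_induct)
  case (insert i A)
  have "m \<le> min (v (f i)) (v (sum f A))" using insert by simp
  thus ?case using v_add[of "f i" "sum f A"] insert by (simp del: min.bounded_iff)
qed (cases m; simp add: v_zero)

lemma v_sum_less:
  assumes "finite A" "\<And>i. i \<in> A \<Longrightarrow> m < v (f i)" "m \<noteq> Infty"
  shows "m < v (sum f A)"
  using assms
proof (induction A rule: finite_induct)
  case (insert i A)
  have "m < min (v (f i)) (v (sum f A))" using insert by simp
  thus ?case using v_add[of "f i" "sum f A"] insert by (simp del: min_less_iff_conj)
qed (cases m; simp add: v_zero)

lemma v_add_eq:
  assumes "v x < v y"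
  shows "v (x + y) = v x"
proof (rule antisym)
  have "min (v (x + y)) (v (- y)) \<le> v x" using v_add[of "x + y" "- y"] by simp
  thus "v (x + y) \<le> v x" using assms by (auto simp: v_minus min_def split: if_splits)
  show "v x \<le> v (x + y)" using v_add[of x y] assms by (simp add: min_def split: if_splits)
qed

end

lemma nat_scale_add: "nat_scale (i + j) \<gamma> = nat_scale i \<gamma> + nat_scale j \<gamma>"
  by (induction j) (auto simp: nat_scale_def algebra_simps)

context
  fixes v :: "'l::field \<Rightarrow> 'g::linordered_ab_group_add with_infty" and \<gamma> :: 'g
  assumes val: "valuation v"
begin

private definition term_val :: "'l poly \<Rightarrow> nat \<Rightarrow> 'g with_infty" where
  "term_val p i = v (coeff p i) + Val (nat_scale i \<gamma>)"

private definition gp :: "'l poly \<Rightarrow> 'g with_infty" where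
  "gp p = (MIN i\<in>{..degree p}. term_val p i)"

private lemma term_val_Infty: "term_val p i = Infty \<longleftrightarrow> coeff p i = 0"
  using v_eq_Infty[OF val, of "coeff p i"] by (cases "v (coeff p i)") (auto simp: term_val_def)

private lemma gp_le: "gp p \<le> term_val p i"
proof (cases "i \<le> degree p")
  case False
  hence "term_val p i = Infty" by (simp add: term_val_Infty coeff_eq_0)
  thus ?thesis by simp
qed (auto simp: gp_def intro!: Min_le)

private lemma gp_attained: "\<exists>i. gp p = term_val p i"
proof -
  have "gp p \<in> term_val p ` {..degree p}" unfolding gp_def by (rule Min_in) auto
  thus ?thesis by auto
qed

private lemma gp_ge_iff: "m \<le> gp p \<longleftrightarrow> (\<forall>i. m \<le> term_val p i)"
  using gp_le gp_attained by (metis order_trans)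

private lemma gp_Infty: "gp p = Infty \<longleftrightarrow> p = 0"
proof
  assume "gp p = Infty"
  hence "term_val p i = Infty" for i
    using gp_le[of p i] by (cases "term_val p i") auto
  thus "p = 0" by (simp add: term_val_Infty poly_eq_iff)
next
  assume "p = 0"
  then show "gp p = Infty" using gp_attained[of p] by (auto simp: term_val_Infty)
qed

private lemma gp_add: "min (gp p) (gp q) \<le> gp (p + q)"
  unfolding gp_ge_iff
proof
  fix i
  have "min (gp p) (gp q) \<le> min (term_val p i) (term_val q i)"
    using gp_le[of p i] gp_le[of q i] by (auto simp: min_le_iff_disj)
  also have "\<dots> = min (v (coeff p i)) (v (coeff q i)) + Val (nat_scale i \<gamma>)"
    by (auto simp: term_val_def min_def with_infty_add_left_cancel)
  also have "\<dots> \<le> term_val (p + q) i"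
    unfolding term_val_def using v_add[OF val, of "coeff p i" "coeff q i"]
    by (simp add: with_infty_add_left_cancel)
  finally show "min (gp p) (gp q) \<le> term_val (p + q) i" .
qed

private lemma term_prod:
  "v (coeff p i * coeff q j) + Val (nat_scale (i + j) \<gamma>) = term_val p i + term_val q j"
proof -
  have "v (coeff p i * coeff q j) + Val (nat_scale (i + j) \<gamma>)
      = v (coeff p i) + v (coeff q j) + (Val (nat_scale i \<gamma>) + Val (nat_scale j \<gamma>))"
    by (simp add: v_mult[OF val] nat_scale_add)
  thus ?thesis by (simp only: term_val_def ac_simps)
qed

private lemma shift_le: "m \<le> x + Val g \<longleftrightarrow> m + Val (- g) \<le> x"
  "m < x + Val g \<longleftrightarrow> m + Val (- g) < x" for m x :: "'g with_infty"
  by (cases m; cases x; simp add: algebra_simps)+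

private lemma gp_mult: "gp (p * q) = gp p + gp q"
proof (cases "p = 0 \<or> q = 0")
  case True
  moreover have "gp 0 = Infty" by (simp add: gp_Infty)
  ultimately show ?thesis by auto
next
  case False
  hence fin: "gp p \<noteq> Infty" "gp q \<noteq> Infty" by (auto simp: gp_Infty)
  show ?thesis
  proof (rule antisym)
    show "gp p + gp q \<le> gp (p * q)"
      unfolding gp_ge_iff
    proof
      fix n
      have "gp p + gp q + Val (- nat_scale n \<gamma>) \<le> v (coeff (p * q) n)"
        unfolding coeff_mult
      proof (rule v_sum_le[OF val])
        fix i assume "i \<in> {..n}"
        hence "v (coeff p i * coeff q (n - i)) + Val (nat_scale n \<gamma>)
          = term_val p i + term_val q (n - i)"
          using term_prod[of p i q "n - i"] by simp
        thus "gp p + gp q + Val (- nat_scale n \<gamma>) \<le> v (coeff p i * coeff q (n - i))"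
          unfolding shift_le(1)[symmetric] by (simp add: add_mono gp_le)
      qed auto
      thus "gp p + gp q \<le> term_val (p * q) n"
        by (simp add: term_val_def shift_le(1))
    qed
  next
    define k where "k = (LEAST i. gp p = term_val p i)"
    define l where "l = (LEAST i. gp q = term_val q i)"
    have k: "gp p = term_val p k" unfolding k_def by (rule LeastI_ex) (rule gp_attained)
    have l: "gp q = term_val q l" unfolding l_def by (rule LeastI_ex) (rule gp_attained)
    have k': "gp p < term_val p i" if "i < k" for i
      using not_less_Least[of i "\<lambda>i. gp p = term_val p i"] that gp_le[of p i] by (auto simp: k_def)
    have l': "gp q < term_val q i" if "i < l" for i
      using not_less_Least[of i "\<lambda>i. gp q = term_val q i"] that gp_le[of q i] by (auto simp: l_def)
    let ?s = "nat_scale (k + l) \<gamma>"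
    let ?f = "\<lambda>i. coeff p i * coeff q (k + l - i)"
    have main: "v (?f k) = gp p + gp q + Val (- ?s)"
    proof -
      have "v (?f k) + Val ?s = gp p + gp q"
        using term_prod[of p k q l] by (simp add: k l)
      thus ?thesis by (cases "v (?f k)"; cases "gp p"; cases "gp q") (auto simp: algebra_simps)
    qed
    have "v (?f k) < v (sum ?f ({..k + l} - {k}))"
      unfolding main
    proof (rule v_sum_less[OF val])
      fix i assume i: "i \<in> {..k + l} - {k}"
      have "gp p + gp q < term_val p i + term_val q (k + l - i)"
      proof (cases "i < k")
        case True
        thus ?thesis using with_infty_add_less_le[OF k' gp_le fin(2)] by simp
      next
        case False
        hence "k + l - i < l" using i by auto
        thus ?thesis
          using with_infty_add_less_le[OF l' gp_le fin(1), of "k + l - i" i] by (simp add: add.commute)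
      qed
      moreover have "v (?f i) + Val ?s = term_val p i + term_val q (k + l - i)"
        using term_prod[of p i q "k + l - i"] i by simp
      ultimately show "gp p + gp q + Val (- ?s) < v (?f i)"
        by (simp add: shift_le(2)[symmetric])
    next
      show "gp p + gp q + Val (- ?s) \<noteq> Infty"
        using fin by (cases "gp p"; cases "gp q") auto
    qed auto
    hence "v (?f k + sum ?f ({..k + l} - {k})) = v (?f k)"
      by (rule v_add_eq[OF val])
    also have "?f k + sum ?f ({..k + l} - {k}) = coeff (p * q) (k + l)"
      unfolding coeff_mult by (rule sum.remove[symmetric]) auto
    finally have "term_val (p * q) (k + l) = gp p + gp q"
      unfolding term_val_def main by (cases "gp p"; cases "gp q") auto
    thus "gp (p * q) \<le> gp p + gp q" using gp_le[of "p * q" "k + l"] by simp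
  qed
qed

private lemma expansion:
  fixes p :: "'l poly"
  shows "p = (\<Sum>i\<le>degree p. smult (coeff (p \<circ>\<^sub>p [:a, 1:]) i) ([:- a, 1:] ^ i))"
proof -
  define q where "q = p \<circ>\<^sub>p [:a, 1:]"
  have deg: "degree q = degree p" 
    using degree_pCons_eq[of 1 a] by (simp only: q_def degree_pcompose) simp
  have "p = q \<circ>\<^sub>p [:- a, 1:]"
  proof -
    have "[:a, 1:] \<circ>\<^sub>p [:- a, 1:] = [:0, 1:]" by (simp add: pcompose_pCons)
    thus ?thesis by (simp only: q_def pcompose_assoc[symmetric] pcompose_idR)
  qed
  also have "q = (\<Sum>i\<le>degree p. monom (coeff q i) i)"
    using poly_as_sum_of_monoms[of q] deg by simp
  also have "\<dots> \<circ>\<^sub>p [:- a, 1:] = (\<Sum>i\<le>degree p. smult (coeff q i) ([:- a, 1:] ^ i))"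
    unfolding pcompose_sum
    by (intro sum.cong refl) (simp add: monom_altdef pcompose_smult pcompose_hom.hom_power pcompose_pCons)
  finally show ?thesis unfolding q_def .
qed

private lemma gp_expansion:
  "gp ((\<Sum>i\<le>n. smult (c i) ([:- a, 1:] ^ i)) \<circ>\<^sub>p [:a, 1:])
     = (MIN i\<in>{..n}. v (c i) + Val (nat_scale i \<gamma>))" (is "gp ?q = ?m")
proof -
  have q: "?q = (\<Sum>i\<le>n. monom (c i) i)"
    unfolding pcompose_sum
    by (intro sum.cong refl) (simp add: monom_altdef pcompose_smult pcompose_hom.hom_power pcompose_pCons)
  have coeff: "coeff ?q i = (if i \<le> n then c i else 0)" for i
    unfolding q by (auto simp: coeff_sum if_distrib cong: if_cong)
  have tv: "term_val ?q i = (if i \<le> n then v (c i) + Val (nat_scale i \<gamma>) else Infty)" for i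
    unfolding term_val_def coeff by (auto simp: v_zero[OF val])
  show ?thesis
  proof (rule antisym)
    show "gp ?q \<le> ?m"
    proof (rule Min.boundedI)
      fix x assume "x \<in> (\<lambda>i. v (c i) + Val (nat_scale i \<gamma>)) ` {..n}"
      then obtain i where "i \<le> n" "x = v (c i) + Val (nat_scale i \<gamma>)" by blast
      hence "x = term_val ?q i" unfolding tv by simp
      thus "gp ?q \<le> x" by (simp only: gp_le)
    qed auto
    show "?m \<le> gp ?q"
      unfolding gp_ge_iff tv by (auto intro!: Min_le)
  qed
qed

lemma ex1_gauss_valuation:
  "\<exists>!w. valuation w \<and>
     (\<forall>c n. w (to_fract (\<Sum>i\<le>n. smult (c i) ([:- a, 1:] ^ i))) =
            (MIN i\<in>{..n}. v (c i) + Val (nat_scale i \<gamma>)))"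
    (is "\<exists>!w. valuation w \<and> ?P w")
proof -
  define g where "g = (\<lambda>p. gp (p \<circ>\<^sub>p [:a, 1:]))"
  have g_mult: "g (p * q) = g p + g q" for p q by (simp add: g_def pcompose_mult gp_mult)
  have g_add: "min (g p) (g q) \<le> g (p + q)" for p q
    by (simp add: g_def pcompose_add gp_add del: min_le_iff_disj)
  have g_Infty: "g p = Infty \<longleftrightarrow> p = 0" for p by (simp add: g_def gp_Infty pcompose_eq_0_iff)
  define d :: "'g with_infty \<Rightarrow> 'g with_infty \<Rightarrow> 'g with_infty" where
    "d = (\<lambda>x y. THE z. z + y = x)"
  have d: "d x y = z" if "z + y = x" "y \<noteq> Infty" for x y z
    unfolding d_def using that with_infty_add_left_cancel(1)[OF that(2)] by (intro the_equality) auto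
  define w :: "'l poly fract \<Rightarrow> 'g with_infty" where
    "w = (\<lambda>f. let (p, q) = SOME (p, q). q \<noteq> 0 \<and> f = Fract p q in d (g p) (g q))"
  have w_eq: "w f + g q = g p" if "f = Fract p q" "q \<noteq> 0" for f p q
  proof -
    obtain p' q' where pq: "(SOME (p, q). q \<noteq> 0 \<and> f = Fract p q) = (p', q')"
      by fastforce
    have "case (p', q') of (p, q) \<Rightarrow> q \<noteq> 0 \<and> f = Fract p q"
      unfolding pq[symmetric] by (rule someI[of _ "(p, q)"]) (use that in auto)
    hence q': "q' \<noteq> 0" "f = Fract p' q'" by auto
    hence "p' * q = p * q'" using that by (simp add: eq_fract)
    hence *: "g p' + g q = g p + g q'" using g_mult by metis
    have "w f = d (g p') (g q')" unfolding w_def pq by simp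
    moreover have fin: "g q' \<noteq> Infty" "g q \<noteq> Infty" using q' that g_Infty by auto
    moreover obtain z where z: "z + g q' = g p'"
    proof (cases "g p'")
      case (Val x)
      moreover obtain y where "g q' = Val y" using fin by (cases "g q'") auto
      ultimately show ?thesis using that[of "Val (x - y)"] by simp
    next
      case Infty
      thus ?thesis using that[of Infty] by simp
    qed
    ultimately have "w f = z" using d[OF z fin(1)] by simp
    have "(z + g q) + g q' = (z + g q') + g q" by (simp only: ac_simps)
    also have "\<dots> = g p + g q'" using * z by simp
    finally show ?thesis using with_infty_add_left_cancel(1)[OF fin(1)] \<open>w f = z\<close> by simp
  qed
  have w_poly: "w (to_fract p) = g p" for p
  proof -
    have "g 1 = 0" using g_mult[of 1 1] g_Infty[of 1]
      by (cases "g 1") (auto simp: zero_with_infty_def)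
    thus ?thesis using w_eq[of "to_fract p" p 1] by (simp add: to_fract_def)
  qed
  show ?thesis
  proof (rule ex1I[where a = w], rule conjI)
    show "?P w" unfolding w_poly g_def gp_expansion by blast
    show "valuation w"
      unfolding valuation_def
    proof (intro conjI allI)
      fix x y :: "'l poly fract"
      obtain p q where x: "x = Fract p q" "q \<noteq> 0" by (cases x) auto
      obtain r s where y: "y = Fract r s" "s \<noteq> 0" by (cases y) auto
      have fin: "g q \<noteq> Infty" "g s \<noteq> Infty" using x y g_Infty by auto
      have wx: "w x + g q = g p" and wy: "w y + g s = g r" using w_eq x y by auto
      have "w x = Infty \<longleftrightarrow> g p = Infty" using wx fin by (cases "w x"; cases "g q") auto
      thus "w x = Infty \<longleftrightarrow> x = 0" using x by (auto simp: g_Infty Zero_fract_def eq_fract)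
      have "w (x * y) + (g q + g s) = g p + g r"
        using w_eq[of "x * y" "p * r" "q * s"] x y by (simp add: g_mult)
      also have "\<dots> = (w x + w y) + (g q + g s)" unfolding wx[symmetric] wy[symmetric] by (simp add: ac_simps)
      finally show "w (x * y) = w x + w y"
        using fin by (subst (asm) with_infty_add_left_cancel) (cases "g q"; cases "g s"; simp)+
      have xy: "w (x + y) + (g q + g s) = g (p * s + r * q)"
        using w_eq[of "x + y" "p * s + r * q" "q * s"] x y by (simp add: g_mult)
      have "min (w x) (w y) + (g q + g s) \<le> min (g (p * s)) (g (r * q))"
      proof -
        have "g (p * s) = w x + (g q + g s)" "g (r * q) = w y + (g q + g s)"
          unfolding g_mult wx[symmetric] wy[symmetric] by (simp_all only: ac_simps)
        thus ?thesis by (simp add: add_right_mono)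
      qed
      also have "\<dots> \<le> w (x + y) + (g q + g s)" unfolding xy by (rule g_add)
      finally show "min (w x) (w y) \<le> w (x + y)"
        using fin by (subst (asm) with_infty_add_left_cancel) (cases "g q"; cases "g s"; simp)+
    qed
  next
    fix w' assume "valuation w' \<and> ?P w'"
    hence w': "valuation w'" and w'_expansion: "?P w'" by (rule conjunct1, rule conjunct2)
    show "w' = w"
    proof
      fix f :: "'l poly fract"
      have poly: "w' (to_fract p) = g p" for p
        by (subst (1 2) expansion[of p a]) (simp only: w'_expansion[rule_format] g_def gp_expansion)
      obtain p q where f: "f = Fract p q" "q \<noteq> 0" by (cases f) auto
      have "f * to_fract q = to_fract p" using f by (simp add: to_fract_def eq_fract)
      hence "w' f + g q = g p" using v_mult[OF w'] poly by metis
      also have "\<dots> = w f + g q" using w_eq f by simp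
      finally show "w' f = w f" using f g_Infty by (subst (asm) with_infty_add_left_cancel) auto
    qed
  qed
qed

lemma valuation_gauss_valuation: "valuation (gauss_valuation v a \<gamma>)"
  and gauss_valuation_expansion:
    "gauss_valuation v a \<gamma> (to_fract (\<Sum>i\<le>n. smult (c i) ([:- a, 1:] ^ i))) =
       (MIN i\<in>{..n}. v (c i) + Val (nat_scale i \<gamma>))"
  using theI'[OF ex1_gauss_valuation[of a], folded gauss_valuation_def] by blast+

lemma gauss_valuation_linear:
  "gauss_valuation v a \<gamma> (to_fract [:- z, 1:]) = min (Val \<gamma>) (v (a - z))"
proof -
  let ?c = "\<lambda>i::nat. if i = 0 then a - z else 1"
  have *: "{..1::nat} = {0, 1}" by auto
  have "(\<Sum>i\<le>1. smult (?c i) ([:- a, 1:] ^ i)) = smult (?c 0) 1 + smult (?c 1) [:- a, 1:]"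
    unfolding * by simp
  also have "\<dots> = [:- z, 1:]" by simp
  finally have "[:- z, 1:] = (\<Sum>i\<le>1. smult (?c i) ([:- a, 1:] ^ i))" ..
  hence "gauss_valuation v a \<gamma> (to_fract [:- z, 1:]) =
      (MIN i\<in>{..1}. v (?c i) + Val (nat_scale i \<gamma>))"
    by (simp only: gauss_valuation_expansion)
  also have "\<dots> = min (v (a - z) + 0) (0 + Val \<gamma>)"
    unfolding * by (simp add: nat_scale_def v_one[OF val] zero_with_infty_def)
  finally show ?thesis by (simp add: min.commute)
qed

end

end

theory Submission
  imports Defs "Jordan_Normal_Form.Char_Poly"
begin

text \<open>
  A partial isomorphism between subfields of $L(X)$, $L = \overline{K}$, that carries $v_{b,\gamma}$
  to $v_{a,\gamma}$ is encoded as a set \<open>R\<close> of pairs closed under the field operations.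
  Condition (i) says that the identity of $K(X)$ is one; take a maximal extension \<open>R\<close> of it.
  Let \<open>x \<in> L\<close>, with minimal polynomial \<open>m = \<Prod>(T - x\<^sub>j)\<close> over the domain of \<open>R\<close>, and let
  \<open>m' = \<Prod>(T - y\<^sub>j)\<close> be the corresponding polynomial over the range.  If no \<open>y\<^sub>j\<close> were
  an admissible image of \<open>x\<close>, a single pair \<open>(p, q)\<close> of corresponding polynomials would have
  \<open>w (p x) \<noteq> w' (q y\<^sub>j)\<close> for all \<open>j\<close>.  But \<open>\<Prod>(T - p x\<^sub>j)\<close> and \<open>\<Prod>(T - q y\<^sub>j)\<close>, being characteristic
  polynomials of the multiplications by \<open>p\<close> modulo \<open>m\<close> and by \<open>q\<close> modulo \<open>m'\<close>, have corresponding
  coefficients, so their Gauss values \<open>\<Sum>\<^sub>j min \<delta> (w (p x\<^sub>j))\<close> and \<open>\<Sum>\<^sub>j min \<delta> (w' (q y\<^sub>j))\<close> agree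
  for every \<open>\<delta>\<close>, which forces the value \<open>w (p x)\<close> to occur among the \<open>w' (q y\<^sub>j)\<close>.
  Hence \<open>R\<close> is defined on all constants, and by symmetry it reaches all of them.  It restricts to
  some \<open>\<sigma>\<close> in the decomposition group; as it maps $X - b$ to $X - \sigma b$, we get
  $\gamma = v_{b,\gamma}(X - b) = v_{a,\gamma}(X - \sigma b) = \min\{\gamma, v(a - \sigma b)\}$.
\<close>

hide_const (open) Module.smult

section \<open>Rings of pairs and their polynomials\<close>

text \<open>A subring of the product ring, standing for the graph of an isomorphism between
  subrings. Neither functionality nor injectivity is built in: both come from
  \<open>isometric\<close>, through \<open>isometric_eq_0_iff\<close>.\<close>

definition pair_ring :: "('a::comm_ring_1 \<times> 'b::comm_ring_1) set \<Rightarrow> bool" where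
  "pair_ring R \<longleftrightarrow> (1, 1) \<in> R \<and>
     (\<forall>x y u v. (x, y) \<in> R \<longrightarrow> (u, v) \<in> R \<longrightarrow> (x - u, y - v) \<in> R \<and> (x * u, y * v) \<in> R)"

text \<open>The polynomial ring over \<open>R\<close>, read as pairs of polynomials. The degrees of
  \<open>p\<close> and \<open>q\<close> may differ if \<open>R\<close> pairs zero with a nonzero
  element.\<close>

definition poly_pairs :: "('a::comm_ring_1 \<times> 'b::comm_ring_1) set \<Rightarrow> ('a poly \<times> 'b poly) set" where
  "poly_pairs R = {(p, q). \<forall>i. (coeff p i, coeff q i) \<in> R}"

context
  fixes R :: "('a::comm_ring_1 \<times> 'b::comm_ring_1) set"
  assumes R: "pair_ring R"
begin

lemma pair_ring_one: "(1, 1) \<in> R"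
  and pair_ring_diff: "(x, y) \<in> R \<Longrightarrow> (u, v) \<in> R \<Longrightarrow> (x - u, y - v) \<in> R"
  and pair_ring_mult: "(x, y) \<in> R \<Longrightarrow> (u, v) \<in> R \<Longrightarrow> (x * u, y * v) \<in> R"
  using R by (auto simp: pair_ring_def)

lemma pair_ring_zero: "(0, 0) \<in> R"
  using pair_ring_diff[OF pair_ring_one pair_ring_one] by simp

lemma pair_ring_uminus: "(x, y) \<in> R \<Longrightarrow> (- x, - y) \<in> R"
  using pair_ring_diff[OF pair_ring_zero] by force

lemma pair_ring_add: "(x, y) \<in> R \<Longrightarrow> (u, v) \<in> R \<Longrightarrow> (x + u, y + v) \<in> R"
  using pair_ring_diff[of x y "- u" "- v"] pair_ring_uminus by simp

lemma pair_ring_sum: "(\<And>i. i \<in> A \<Longrightarrow> (f i, g i) \<in> R) \<Longrightarrow> (sum f A, sum g A) \<in> R"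
  by (induction A rule: infinite_finite_induct) (auto intro: pair_ring_zero pair_ring_add)

lemma pair_ring_prod: "(\<And>i. i \<in> A \<Longrightarrow> (f i, g i) \<in> R) \<Longrightarrow> (prod f A, prod g A) \<in> R"
  by (induction A rule: infinite_finite_induct) (auto intro: pair_ring_one pair_ring_mult)

lemma pair_ring_power: "(x, y) \<in> R \<Longrightarrow> (x ^ n, y ^ n) \<in> R"
  by (induction n) (auto intro: pair_ring_one pair_ring_mult)

lemma pair_ring_poly_pairs: "pair_ring (poly_pairs R)"
  unfolding pair_ring_def poly_pairs_def
  by (auto simp: coeff_mult coeff_1 intro!: pair_ring_one pair_ring_zero pair_ring_diff
      pair_ring_sum pair_ring_mult)

lemma poly_pairs_monom: "(x, y) \<in> R \<Longrightarrow> (monom x n, monom y n) \<in> poly_pairs R"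
  by (auto simp: poly_pairs_def pair_ring_zero)

lemma poly_pairs_const: "(x, y) \<in> R \<Longrightarrow> ([:x:], [:y:]) \<in> poly_pairs R"
  using poly_pairs_monom[of x y 0] by (simp add: monom_0)

lemma poly_pairs_X: "([:0, 1:], [:0, 1:]) \<in> poly_pairs R"
  using poly_pairs_monom[OF pair_ring_one, of 1] by (simp add: monom_altdef)

lemma pair_ring_poly:
  assumes "(p, q) \<in> poly_pairs R" "(x, y) \<in> R"
  shows "(poly p x, poly q y) \<in> R"
proof -
  let ?n = "max (degree p) (degree q)"
  have "poly p x = (\<Sum>i\<le>?n. coeff p i * x ^ i)" "poly q y = (\<Sum>i\<le>?n. coeff q i * y ^ i)"
    by (auto simp: poly_altdef coeff_eq_0 intro!: sum.mono_neutral_left le_degree)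
  thus ?thesis
    using assms by (auto simp: poly_pairs_def intro!: pair_ring_sum pair_ring_mult pair_ring_power)
qed

text \<open>The Leibniz formula builds a determinant from entries and signs by ring operations only,
  and each sign is paired with itself.\<close>

lemma pair_ring_det:
  assumes "\<And>i j. i < n \<Longrightarrow> j < n \<Longrightarrow> (f i j, g i j) \<in> R"
  shows "(det (mat n n (\<lambda>(i, j). f i j)), det (mat n n (\<lambda>(i, j). g i j))) \<in> R"
proof -
  have sign: "(signof p, signof p) \<in> R" for p :: "nat \<Rightarrow> nat"
    by (auto simp: sign_def pair_ring_one intro!: pair_ring_uminus)
  show ?thesis
    by (auto simp: det_def intro!: pair_ring_sum pair_ring_mult pair_ring_prod sign assms)
qed

end

section \<open>Division and characteristic polynomials in both components at once\<close>

text \<open>Long division by monic divisors involves no inversion, so a ring of pairs suffices.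
  Bounding the remainders by vanishing coefficients instead of degrees also fits
  \<open>n = 0\<close>, where they are zero.\<close>

lemma poly_pairs_division:
  assumes R: "pair_ring R" and fg: "(f, g) \<in> poly_pairs R" "lead_coeff f = 1" "lead_coeff g = 1"
    "degree f = n" "degree g = n"
    and "(p, q) \<in> poly_pairs R"
  obtains s t r u where "(s, t) \<in> poly_pairs R" "(r, u) \<in> poly_pairs R"
    "p = f * s + r" "q = g * t + u" "\<And>i. i \<ge> n \<Longrightarrow> coeff r i = 0 \<and> coeff u i = 0"
proof -
  have "\<exists>s t r u. (s, t) \<in> poly_pairs R \<and> (r, u) \<in> poly_pairs R \<and>
      p = f * s + r \<and> q = g * t + u \<and> (\<forall>i\<ge>n. coeff r i = 0 \<and> coeff u i = 0)"
    if "(p, q) \<in> poly_pairs R" "\<forall>i\<ge>N. coeff p i = 0 \<and> coeff q i = 0" for p q N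
    using that
  proof (induction N arbitrary: p q)
    case 0
    hence "p = 0" "q = 0" by (auto simp: poly_eq_iff)
    thus ?case by (intro exI[of _ 0]) (auto simp: poly_pairs_def pair_ring_zero[OF R])
  next
    case (Suc N)
    note pp = pair_ring_poly_pairs[OF R]
    show ?case
    proof (cases "N < n")
      case True
      thus ?thesis using Suc.prems
        by (intro exI[of _ 0] exI[of _ p] exI[of _ q]) (auto simp: poly_pairs_def pair_ring_zero[OF R])
    next
      case False
      \<comment> \<open>Both divisors are monic of degree \<open>n\<close>, so one step kills the
        coefficients at \<open>N\<close> in both components, even if one of them is already
        zero.\<close>
      let ?m = "monom (coeff p N) (N - n)" and ?m' = "monom (coeff q N) (N - n)"
      have m: "(?m, ?m') \<in> poly_pairs R"
        using Suc.prems(1) by (intro poly_pairs_monom[OF R]) (auto simp: poly_pairs_def)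
      have 1: "(p - f * ?m, q - g * ?m') \<in> poly_pairs R"
        by (intro pair_ring_diff[OF pp] pair_ring_mult[OF pp] m fg Suc.prems)
      have 2: "coeff (p - f * ?m) i = 0 \<and> coeff (q - g * ?m') i = 0" if "i \<ge> N" for i
      proof (cases "i = N")
        case True
        thus ?thesis using False fg by (simp add: mult.commute[of _ "monom _ _"] coeff_monom_mult)
      next
        case i: False
        thus ?thesis using False fg Suc.prems that
          by (auto simp: mult.commute[of _ "monom _ _"] coeff_monom_mult coeff_eq_0)
      qed
      from Suc.IH[OF 1] 2 obtain s t r u where *: "(s, t) \<in> poly_pairs R" "(r, u) \<in> poly_pairs R"
        "p - f * ?m = f * s + r" "q - g * ?m' = g * t + u" "\<forall>i\<ge>n. coeff r i = 0 \<and> coeff u i = 0"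
        by blast
      have "p = f * (s + ?m) + r" "q = g * (t + ?m') + u"
        using *(3,4) by (auto simp: algebra_simps)
      moreover have "(s + ?m, t + ?m') \<in> poly_pairs R"
        by (intro pair_ring_add[OF pp] * m)
      ultimately show ?thesis using *(2,5) by blast
    qed
  qed
  from this[OF assms(7), of "Suc (max (degree p) (degree q))"] that show ?thesis
    by (auto simp: coeff_eq_0)
qed

text \<open>A characteristic polynomial is a determinant of polynomials, so
  \<open>pair_ring_det\<close> applies to the ring \<open>poly_pairs R\<close>.\<close>

lemma poly_pairs_char_poly:
  assumes R: "pair_ring R" and fg: "\<And>i j. i < n \<Longrightarrow> j < n \<Longrightarrow> (f i j, g i j) \<in> R"
  shows "(char_poly (mat n n (\<lambda>(i, j). f i j)), char_poly (mat n n (\<lambda>(i, j). g i j))) \<in> poly_pairs R"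
proof -
  have char_poly: "char_poly (mat n n (\<lambda>(i, j). h i j)) =
      det (mat n n (\<lambda>(i, j). (if i = j then [:0, 1:] else 0) - [:h i j:]))" for h :: "nat \<Rightarrow> nat \<Rightarrow> 'c::comm_ring_1"
    unfolding char_poly_defs by (rule arg_cong[of _ _ det]) (auto intro!: eq_matI)
  note pp = pair_ring_poly_pairs[OF R]
  show ?thesis unfolding char_poly
    by (intro pair_ring_det[OF pp] pair_ring_diff[OF pp] poly_pairs_const[OF R] fg)
      (auto simp: poly_pairs_X[OF R, simplified] pair_ring_zero[OF pp])
qed

section \<open>Characteristic polynomials of multiplication maps\<close>

lemma degree_prod_list_linear:
  "degree (\<Prod>x\<leftarrow>xs. [:- x, 1::'a::idom:]) = length xs" "lead_coeff (\<Prod>x\<leftarrow>xs. [:- x, 1::'a::idom:]) = 1"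
proof -
  have "lead_coeff (\<Prod>x\<leftarrow>xs. [:- x, 1::'a::idom:]) = 1 \<and> degree (\<Prod>x\<leftarrow>xs. [:- x, 1::'a::idom:]) = length xs" for xs
  proof (induction xs)
    case (Cons x xs)
    hence "(\<Prod>x\<leftarrow>xs. [:- x, 1:]) \<noteq> 0" by auto
    moreover have "lead_coeff ([:- x, 1:] * (\<Prod>x\<leftarrow>xs. [:- x, 1:])) = 1"
      unfolding lead_coeff_mult using Cons[THEN conjunct1] by simp
    moreover have "degree ([:- x, 1:] * (\<Prod>x\<leftarrow>xs. [:- x, 1:])) = Suc (length xs)"
      using Cons calculation by (subst degree_mult_eq) auto
    ultimately show ?case by (simp only: list.map prod_list.Cons list.size) simp
  qed simp
  thus "degree (\<Prod>x\<leftarrow>xs. [:- x, 1::'a::idom:]) = length xs" "lead_coeff (\<Prod>x\<leftarrow>xs. [:- x, 1::'a::idom:]) = 1"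
    by blast+
qed

text \<open>Writing q = q(x_i) + (X - x_i) u turns N_i q into q(x_i) N_i + N_{i+1} u, and the
  process continues with u. The roots may repeat.\<close>

lemma Newton_expansion:
  fixes xs :: "'a::idom list"
  defines "N \<equiv> \<lambda>i. \<Prod>x\<leftarrow>take i xs. [:- x, 1:]"
  assumes "i < length xs" "degree (N i * q) < length xs"
  shows "\<exists>c. N i * q = (\<Sum>l=i..<length xs. smult (c l) (N l)) \<and> c i = poly q (xs ! i)"
  using assms(2,3)
proof (induction "length xs - i" arbitrary: i q)
  case (Suc d)
  have lead: "lead_coeff (N l) = 1" for l unfolding N_def by (rule degree_prod_list_linear)
  have deg: "degree (N l) = l" if "l \<le> length xs" for l
    using that degree_prod_list_linear(1)[of "take l xs"] unfolding N_def by simp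
  have N_Suc: "N (Suc i) = N i * [:- (xs ! i), 1:]"
    unfolding N_def by (simp only: take_Suc_conv_app_nth[OF Suc.prems(1)]) simp
  define c where "c = poly q (xs ! i)"
  have "[:- (xs ! i), 1:] dvd q - [:c:]" unfolding c_def
    by (rule iffD1[OF poly_eq_0_iff_dvd]) simp
  then obtain u where u: "q = [:c:] + [:- (xs ! i), 1:] * u"
    by (auto simp: dvd_def algebra_simps)
  have Nq: "N i * q = smult c (N i) + N (Suc i) * u"
  proof -
    have "N i * [:c:] = smult c (N i)" by simp
    thus ?thesis by (simp only: N_Suc u distrib_left mult.assoc)
  qed
  have N0: "N l \<noteq> 0" for l using lead[of l] by auto
  have lt: "degree (N (Suc i) * u) < length xs"
  proof -
    have "N (Suc i) * u = N i * q - smult c (N i)" by (simp add: Nq)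
    moreover have "degree (smult c (N i)) < length xs"
      using degree_smult_le[of c "N i"] deg[of i] Suc.prems by simp
    ultimately show ?thesis using Suc.prems by (simp add: degree_diff_less)
  qed
  show ?case
  proof (cases "Suc i < length xs")
    case True
    obtain d where d: "N (Suc i) * u = (\<Sum>l=Suc i..<length xs. smult (d l) (N l))"
    proof -
      have "d = length xs - Suc i" using Suc.hyps(2) by simp
      from Suc.hyps(1)[OF this True lt] that show thesis by blast
    qed
    show ?thesis
      by (rule exI[of _ "d(i := c)"])
        (use Suc.prems(1) in \<open>auto simp: Nq d c_def[symmetric] sum.atLeast_Suc_lessThan intro!: sum.cong\<close>)
  next
    case False
    hence "Suc i = length xs" using Suc.prems by simp
    \<comment> \<open>Past the last root the degree bound excludes a nonzero multiple of
      \<open>N (Suc i)\<close>.\<close>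
    have "u = 0"
    proof (rule ccontr)
      assume "u \<noteq> 0"
      thus False using lt False N0 deg[of "Suc i"] Suc.prems by (simp add: degree_mult_eq)
    qed
    thus ?thesis
      by (intro exI[of _ "\<lambda>_. c"]) (use False Suc.prems in \<open>simp add: Nq flip: c_def \<open>Suc i = length xs\<close>\<close>)
  qed
qed simp

text \<open>
  In the Newton basis \<open>\<Prod>\<^sub>j\<^sub><\<^sub>i (X - x\<^sub>j)\<close>, multiplication by \<open>p\<close> is triangular with diagonal \<open>p x\<^sub>i\<close>.
  This also covers multiple roots, where a Vandermonde argument would fail.
\<close>
lemma char_poly_multiplication_matrix:
  fixes xs :: "'a::field list"
  defines "n \<equiv> length xs"
  assumes dvd: "\<And>i. i < n \<Longrightarrow> (\<Prod>x\<leftarrow>xs. [:- x, 1:]) dvd monom 1 i * p - r i"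
    and coeff_r: "\<And>i k. i < n \<Longrightarrow> n \<le> k \<Longrightarrow> coeff (r i) k = 0"
  shows "char_poly (mat n n (\<lambda>(i, k). coeff (r i) k)) = (\<Prod>x\<leftarrow>xs. [:- poly p x, 1:])"
proof -
  define f where "f = (\<Prod>x\<leftarrow>xs. [:- x, 1:])"
  define N where "N = (\<lambda>i. \<Prod>x\<leftarrow>take i xs. [:- x, 1:])"
  have lead: "lead_coeff (N l) = 1" for l unfolding N_def by (rule degree_prod_list_linear)
  have deg: "degree (N l) = l" if "l \<le> n" for l
    using that degree_prod_list_linear(1)[of "take l xs"] unfolding N_def n_def by simp
  \<comment> \<open>By linearity this is the remainder of \<open>N i * p\<close> modulo
    \<open>f\<close>, as the \<open>r l\<close> are those of the monomial multiples of
    \<open>p\<close>.\<close>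
  define \<rho> where "\<rho> = (\<lambda>i. \<Sum>l<n. smult (coeff (N i) l) (r l))"
  have "\<exists>c. \<rho> i = (\<Sum>l=i..<n. smult (c l) (N l)) \<and> c i = poly p (xs ! i)" if i: "i < n" for i
  proof -
    have "N i = (\<Sum>l<n. monom (coeff (N i) l) l)"
      using poly_as_sum_of_monoms'[of "N i" "n - 1"] deg[of i] i
      by (simp add: lessThan_Suc_atMost[symmetric])
    hence "N i * p - \<rho> i = (\<Sum>l<n. monom (coeff (N i) l) l) * p - \<rho> i" by simp
    also have "\<dots> = (\<Sum>l<n. smult (coeff (N i) l) (monom 1 l * p - r l))"
      unfolding \<rho>_def by (simp add: sum_distrib_right sum_subtractf smult_diff_right smult_monom flip: mult_smult_left)
    also have "f dvd \<dots>"
      unfolding f_def by (intro dvd_sum dvd_smult dvd) auto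
    finally obtain u where u: "N i * p - \<rho> i = f * u" by blast
    have "xs = take i xs @ xs ! i # drop (Suc i) xs"
      using i id_take_nth_drop unfolding n_def by blast
    hence "f = (\<Prod>x\<leftarrow>take i xs @ xs ! i # drop (Suc i) xs. [:- x, 1:])"
      unfolding f_def by simp
    then obtain G where G: "f = N i * ([:- (xs ! i), 1:] * G)"
      unfolding N_def by (simp only: map_append list.map prod_list.append prod_list.Cons)
    \<comment> \<open>Since \<open>N i\<close> divides \<open>f\<close>, it divides the remainder
      too, and the cofactor agrees with \<open>p\<close> at \<open>xs ! i\<close>.\<close>
    have \<rho>: "\<rho> i = N i * (p - [:- (xs ! i), 1:] * G * u)"
      using u unfolding G by (simp add: algebra_simps del: mult_pCons_left mult_pCons_right)
    have "coeff (\<rho> i) k = 0" if "n \<le> k" for k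
      using coeff_r that by (simp add: \<rho>_def coeff_sum)
    hence "degree (\<rho> i) \<le> n - 1" by (intro degree_le) auto
    hence "degree (\<rho> i) < n" using i by simp
    with Newton_expansion[of i xs "p - [:- (xs ! i), 1:] * G * u"] i
    show ?thesis unfolding \<rho> N_def n_def by simp
  qed
  then obtain C where C: "\<And>i. i < n \<Longrightarrow> \<rho> i = (\<Sum>l=i..<n. smult (C i l) (N l))"
    and C_diag: "\<And>i. i < n \<Longrightarrow> C i i = poly p (xs ! i)" by metis
  \<comment> \<open>\<open>A\<close> and \<open>B\<close> describe, by rows, multiplication by
    \<open>p\<close> in the monomial and in the Newton basis; \<open>S\<close> is the change of
    basis.\<close>
  define A where "A = mat n n (\<lambda>(i, k). coeff (r i) k)"
  define B where "B = mat n n (\<lambda>(i, l). if l < i then 0 else C i l)"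
  define S where "S = mat n n (\<lambda>(i, l). coeff (N i) l)"
  have dims: "A \<in> carrier_mat n n" "B \<in> carrier_mat n n" "S \<in> carrier_mat n n"
    by (auto simp: A_def B_def S_def)
  have SA: "S * A = B * S"
  proof (rule eq_matI)
    fix i k assume "i < dim_row (B * S)" "k < dim_col (B * S)"
    hence ik: "i < n" "k < n" using dims by auto
    have "(S * A) $$ (i, k) = coeff (\<rho> i) k"
      using ik by (simp add: S_def A_def scalar_prod_def \<rho>_def coeff_sum lessThan_atLeast0)
    also have "\<dots> = (\<Sum>l=i..<n. C i l * coeff (N l) k)"
      using ik by (simp add: C coeff_sum)
    also have "\<dots> = (\<Sum>l=0..<n. (if l < i then 0 else C i l) * coeff (N l) k)"
      by (rule sum.mono_neutral_cong_left) auto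
    also have "\<dots> = (B * S) $$ (i, k)"
      using ik by (simp add: S_def B_def scalar_prod_def)
    finally show "(S * A) $$ (i, k) = (B * S) $$ (i, k)" .
  qed (use dims in auto)
  have "det S = prod_list (diag_mat S)"
    by (rule det_lower_triangular[OF _ dims(3)]) (auto simp: S_def deg coeff_eq_0)
  also have "diag_mat S = map (\<lambda>_. 1) [0..<n]"
    using lead deg by (auto simp: diag_mat_def S_def) (metis less_imp_le)
  finally have "det S \<noteq> 0" by (simp add: map_replicate_const)
  then obtain S' where S': "S' \<in> carrier_mat n n" "S * S' = 1\<^sub>m n" "S' * S = 1\<^sub>m n"
    using det_non_zero_imp_unit[OF dims(3)] unfolding Units_def ring_mat_def by auto
  have "A = S' * B * S"
  proof -
    have "A = (S' * S) * A" using S' dims by simp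
    also have "\<dots> = S' * (B * S)" using S' dims SA by (metis assoc_mult_mat)
    finally show ?thesis using S' dims by (metis assoc_mult_mat)
  qed
  hence "similar_mat_wit A B S' S"
    using S' dims unfolding similar_mat_wit_def by (auto simp: Let_def)
  hence "char_poly A = char_poly B"
    by (intro char_poly_similar) (auto simp: similar_mat_def)
  also have "\<dots> = (\<Prod>a\<leftarrow>diag_mat B. [:- a, 1:])"
    by (rule char_poly_upper_triangular[OF dims(2)]) (auto simp: B_def)
  also have "diag_mat B = map (poly p) xs"
    using C_diag by (intro nth_equalityI) (auto simp: diag_mat_def B_def n_def)
  finally show ?thesis by (simp add: A_def o_def)
qed

section \<open>Gauss valuations and isometric pairs\<close>

text \<open>Single roots need not correspond under \<open>R\<close>, but both products are
  characteristic polynomials of multiplication maps, by \<open>p\<close> and by \<open>q\<close>.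
  Division in pairs makes the two matrices correspond entry by entry.\<close>

lemma poly_pairs_prod_linear_values:
  fixes R :: "('a::field \<times> 'b::field) set"
  assumes R: "pair_ring R" and len: "length xs = length ys"
    and xy: "((\<Prod>x\<leftarrow>xs. [:- x, 1:]), (\<Prod>y\<leftarrow>ys. [:- y, 1:])) \<in> poly_pairs R"
    and pq: "(p, q) \<in> poly_pairs R"
  shows "((\<Prod>x\<leftarrow>xs. [:- poly p x, 1:]), (\<Prod>y\<leftarrow>ys. [:- poly q y, 1:])) \<in> poly_pairs R"
proof -
  let ?n = "length xs" and ?f = "\<Prod>x\<leftarrow>xs. [:- x, 1:]" and ?g = "\<Prod>y\<leftarrow>ys. [:- y, 1:]"
  note pp = pair_ring_poly_pairs[OF R]
  have "\<exists>r u. (r, u) \<in> poly_pairs R \<and> ?f dvd monom 1 i * p - r \<and> ?g dvd monom 1 i * q - u \<and>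
      (\<forall>k\<ge>?n. coeff r k = 0 \<and> coeff u k = 0)" for i
  proof -
    have "(monom 1 i * p, monom 1 i * q) \<in> poly_pairs R"
      by (intro pair_ring_mult[OF pp] pq poly_pairs_monom[OF R] pair_ring_one[OF R])
    then obtain s t r u where "(s, t) \<in> poly_pairs R" "(r, u) \<in> poly_pairs R"
      "monom 1 i * p = ?f * s + r" "monom 1 i * q = ?g * t + u"
      "\<And>k. k \<ge> ?n \<Longrightarrow> coeff r k = 0 \<and> coeff u k = 0"
      using poly_pairs_division[OF R xy degree_prod_list_linear(2) degree_prod_list_linear(2)
          degree_prod_list_linear(1)] len degree_prod_list_linear(1)[of ys] by metis
    thus ?thesis by (intro exI[of _ r] exI[of _ u]) auto
  qed
  then obtain r u where ru: "\<And>i. (r i, u i) \<in> poly_pairs R"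
    "\<And>i. ?f dvd monom 1 i * p - r i" "\<And>i. ?g dvd monom 1 i * q - u i"
    "\<And>i k. k \<ge> ?n \<Longrightarrow> coeff (r i) k = 0" "\<And>i k. k \<ge> ?n \<Longrightarrow> coeff (u i) k = 0"
    by metis
  have "(char_poly (mat ?n ?n (\<lambda>(i, k). coeff (r i) k)),
      char_poly (mat ?n ?n (\<lambda>(i, k). coeff (u i) k))) \<in> poly_pairs R"
    by (rule poly_pairs_char_poly[OF R]) (use ru(1) in \<open>auto simp: poly_pairs_def\<close>)
  thus ?thesis
    using char_poly_multiplication_matrix[of xs p r] char_poly_multiplication_matrix[of ys q u] ru len
    by simp
qed

lemma gauss_valuation_const:
  assumes "valuation v"
  shows "gauss_valuation v a \<gamma> (to_fract [:c:]) = v c"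
proof -
  have "gauss_valuation v a \<gamma> (to_fract [:c:]) =
      gauss_valuation v a \<gamma> (to_fract (\<Sum>i\<le>0. smult ((\<lambda>_. c) i) ([:- a, 1:] ^ i)))" by simp
  also have "\<dots> = v c"
    unfolding gauss_valuation_expansion[OF assms]
    by (simp add: nat_scale_def flip: zero_with_infty_def)
  finally show ?thesis .
qed

text \<open>For \<open>a = 0\<close> and varying \<gamma> the sum acts as a Newton polygon, from
  which \<open>Val_in_set_if_sum_min_eq\<close> reads off values of roots.\<close>

lemma gauss_valuation_prod_linear:
  assumes "valuation v"
  shows "gauss_valuation v a \<gamma> (to_fract (smult c (\<Prod>x\<leftarrow>xs. [:- x, 1:]))) =
    v c + (\<Sum>x\<leftarrow>xs. min (Val \<gamma>) (v (a - x)))"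
proof -
  let ?w = "gauss_valuation v a \<gamma>"
  note mult = v_mult[OF valuation_gauss_valuation[OF assms]]
  have 1: "?w (to_fract (\<Prod>x\<leftarrow>xs. [:- x, 1:])) = (\<Sum>x\<leftarrow>xs. min (Val \<gamma>) (v (a - x)))"
  proof (induction xs)
    case Nil
    show ?case using gauss_valuation_const[OF assms, of a \<gamma> 1] v_one[OF assms] by simp
  next
    case (Cons x xs)
    thus ?case
      by (simp only: list.map prod_list.Cons sum_list.Cons to_fract_hom.hom_mult mult gauss_valuation_linear[OF assms])
  qed
  have "smult c (\<Prod>x\<leftarrow>xs. [:- x, 1:]) = [:c:] * (\<Prod>x\<leftarrow>xs. [:- x, 1:])" by simp
  thus ?thesis
    by (simp only: to_fract_hom.hom_mult mult gauss_valuation_const[OF assms] 1)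
qed

definition isometric :: "('a \<Rightarrow> 'c) \<Rightarrow> ('b \<Rightarrow> 'c) \<Rightarrow> ('a \<times> 'b) set \<Rightarrow> bool" where
  "isometric w w' R \<longleftrightarrow> (\<forall>(x, y)\<in>R. w x = w' y)"

lemma isometricD: "isometric w w' R \<Longrightarrow> (x, y) \<in> R \<Longrightarrow> w x = w' y"
  by (auto simp: isometric_def)

text \<open>A Gauss valuation centred at 0 sees only the values of the coefficients. Padding both
  polynomials to the common length \<open>n\<close> adds only infinite values.\<close>

lemma gauss_valuation_poly_pairs:
  assumes w: "valuation w" "valuation w'" "isometric w w' R" and pq: "(p, q) \<in> poly_pairs R"
  shows "gauss_valuation w 0 \<gamma> (to_fract p) = gauss_valuation w' 0 \<gamma> (to_fract q)"
proof -
  define n where "n = max (degree p) (degree q)"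
  have exp: "p = (\<Sum>i\<le>n. smult (coeff p i) ([:- 0, 1:] ^ i))" if "degree p \<le> n" for p :: "'x::field poly"
    using poly_as_sum_of_monoms'[OF that] by (simp add: monom_altdef)
  have "w (coeff p i) = w' (coeff q i)" for i
    using pq by (intro isometricD[OF w(3)]) (simp add: poly_pairs_def)
  moreover have "gauss_valuation w 0 \<gamma> (to_fract p) = (MIN i\<in>{..n}. w (coeff p i) + Val (nat_scale i \<gamma>))"
    by (subst exp) (simp_all only: gauss_valuation_expansion[OF w(1)], simp add: n_def)
  moreover have "gauss_valuation w' 0 \<gamma> (to_fract q) = (MIN i\<in>{..n}. w' (coeff q i) + Val (nat_scale i \<gamma>))"
    by (subst exp) (simp_all only: gauss_valuation_expansion[OF w(2)], simp add: n_def)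
  ultimately show ?thesis by simp
qed

text \<open>
  The negated second difference of \<open>\<gamma> \<mapsto> min \<gamma> x\<close> at \<open>a\<close>, with a step \<open>\<epsilon>\<close> at most the distance of \<open>a\<close> to
  the finite values in \<open>qs\<close>, is positive for \<open>x = a\<close> and vanishes on \<open>qs\<close>.  In the trivial group
  there is no such \<open>\<epsilon>\<close>, and the claim fails without \<open>b\<close>.
\<close>
lemma Val_in_set_if_sum_min_eq:
  fixes ps qs :: "'g::linordered_ab_group_add with_infty list"
  assumes eq: "\<And>\<gamma>. (\<Sum>p\<leftarrow>ps. min (Val \<gamma>) p) = (\<Sum>q\<leftarrow>qs. min (Val \<gamma>) q)"
    and a: "Val a \<in> set ps" and b: "Val b \<in> set qs"
  shows "Val a \<in> set qs"
proof (rule ccontr)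
  assume not: "Val a \<notin> set qs"
  \<comment> \<open>Truncation at a finite bound is always finite; \<open>m\<close> is its value in
    the group itself, where differences make sense.\<close>
  define m :: "'g \<Rightarrow> 'g with_infty \<Rightarrow> 'g" where
    "m = (\<lambda>\<gamma> x. case x of Infty \<Rightarrow> \<gamma> | Val y \<Rightarrow> min \<gamma> y)"
  have m: "min (Val \<gamma>) x = Val (m \<gamma> x)" for \<gamma> x
    by (cases x) (auto simp: m_def min_def)
  have sum_m: "(\<Sum>x\<leftarrow>xs. min (Val \<gamma>) x) = Val (\<Sum>x\<leftarrow>xs. m \<gamma> x)" for \<gamma> xs
    unfolding m by (induction xs) (auto simp: zero_with_infty_def)
  \<comment> \<open>The distances from \<open>a\<close> to the finite values in \<open>qs\<close>;
    \<open>b\<close> makes this set nonempty.\<close>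
  define D where "D = (\<lambda>y. max (y - a) (a - y)) ` {y. Val y \<in> set qs}"
  have "{y. Val y \<in> set qs} = Val -` set qs" by auto
  hence fin: "finite D" unfolding D_def by (auto intro!: finite_vimageI injI)
  define \<epsilon> where "\<epsilon> = Min D"
  have "\<epsilon> \<in> D" unfolding \<epsilon>_def using b by (intro Min_in fin) (auto simp: D_def)
  hence \<epsilon>: "\<epsilon> > 0" using not by (auto simp: D_def less_max_iff_disj not_less) (metis order.not_eq_order_implies_strict)
  have \<epsilon>_le: "\<epsilon> \<le> max (y - a) (a - y)" if "Val y \<in> set qs" for y
    unfolding \<epsilon>_def using that by (intro Min_le fin) (auto simp: D_def)
  define h where "h = (\<lambda>x. m a x + m a x - m (a - \<epsilon>) x - m (a + \<epsilon>) x)"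
  have "(\<Sum>x\<leftarrow>xs. h x) = (\<Sum>x\<leftarrow>xs. m a x) + (\<Sum>x\<leftarrow>xs. m a x) - (\<Sum>x\<leftarrow>xs. m (a - \<epsilon>) x) - (\<Sum>x\<leftarrow>xs. m (a + \<epsilon>) x)" for xs
    unfolding h_def by (induction xs) (auto simp: algebra_simps)
  hence "(\<Sum>x\<leftarrow>ps. h x) = (\<Sum>x\<leftarrow>qs. h x)" using eq unfolding sum_m by simp
  also have "\<dots> = 0"
  proof -
    have "h x = 0" if "x \<in> set qs" for x
    proof (cases x)
      case (Val y)
      have a: "a - \<epsilon> \<le> a" "a \<le> a + \<epsilon>" using \<epsilon> by simp_all
      \<comment> \<open>Outside the open interval the three truncations are either all the bound or
        all \<open>y\<close>, so the second difference vanishes.\<close>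
      have "a + \<epsilon> \<le> y \<or> y \<le> a - \<epsilon>"
        using Val \<epsilon>_le[of y] that by (auto simp: le_max_iff_disj algebra_simps)
      thus ?thesis
      proof
        assume y: "a + \<epsilon> \<le> y"
        hence "a \<le> y" "a - \<epsilon> \<le> y" using a by (blast intro: order_trans)+
        thus ?thesis using y unfolding Val by (simp add: h_def m_def min_absorb1)
      next
        assume y: "y \<le> a - \<epsilon>"
        hence "y \<le> a" "y \<le> a + \<epsilon>" using a by (blast intro: order_trans)+
        thus ?thesis using y unfolding Val by (simp add: h_def m_def min_absorb2)
      qed
    qed (simp add: h_def m_def)
    hence "map h qs = map (\<lambda>_. 0) qs" by simp
    thus ?thesis by (metis sum_list_0)
  qed
  finally have 0: "(\<Sum>x\<leftarrow>ps. h x) = 0" .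
  have nonneg: "h x \<ge> 0" for x
  proof (cases x)
    case (Val y)
    have a: "a - \<epsilon> \<le> a" "a \<le> a + \<epsilon>" using \<epsilon> by simp_all
    show ?thesis
    proof (cases "a \<le> y")
      case True
      hence "a - \<epsilon> \<le> y" using a by (blast intro: order_trans)
      hence "h x = (a + \<epsilon>) - min (a + \<epsilon>) y"
        using True unfolding Val by (simp add: h_def m_def min_absorb1)
      thus ?thesis by simp
    next
      case False
      hence "y \<le> a" by simp
      hence "y \<le> a + \<epsilon>" using a by (blast intro: order_trans)
      with \<open>y \<le> a\<close> have "h x = y - min (a - \<epsilon>) y"
        unfolding Val by (simp add: h_def m_def min_absorb2)
      thus ?thesis by simp
    qed
  qed (simp add: h_def m_def)
  obtain us vs where ps: "ps = us @ Val a # vs" using a by (auto simp: in_set_conv_decomp)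
  have "h (Val a) = \<epsilon>" using \<epsilon> by (auto simp add: h_def m_def min_def)
  moreover have "(\<Sum>x\<leftarrow>us. h x) \<ge> 0" "(\<Sum>x\<leftarrow>vs. h x) \<ge> 0"
    using nonneg by (auto intro!: sum_list_nonneg)
  ultimately have "(\<Sum>x\<leftarrow>ps. h x) > 0" using \<epsilon> unfolding ps
    by (simp add: add_nonneg_pos add_pos_nonneg)
  with 0 show False by simp
qed

section \<open>Separating an element from finitely many others by one polynomial\<close>

text \<open>Ordered abelian groups are torsion-free: a strict inequality between two values survives
  taking positive multiples.\<close>

lemma valuation_power_eqD:
  fixes v :: "'a::field \<Rightarrow> 'g::linordered_ab_group_add with_infty" and v' :: "'b::field \<Rightarrow> 'g with_infty"
  assumes v: "valuation v" "valuation v'" and "n > 0" and eq: "v (x ^ n) = v' (y ^ n)"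
  shows "v x = v' y"
proof (cases "x = 0 \<or> y = 0")
  case True
  thus ?thesis using eq \<open>n > 0\<close> v_eq_Infty[OF v(1)] v_eq_Infty[OF v(2)]
    by (metis power_eq_0_iff zero_power)
next
  case False
  have strict: "u (x ^ Suc k) < u' (y ^ Suc k)"
    if u: "valuation u" "valuation u'" "u x < u' y" "x \<noteq> 0"
    for u :: "'c::field \<Rightarrow> 'g with_infty" and u' :: "'d::field \<Rightarrow> 'g with_infty" and x y k
  proof (induction k)
    case (Suc k)
    have "u x \<noteq> Infty" using v_eq_Infty[OF u(1)] u(4) by blast
    from with_infty_add_less_le[OF Suc _ this] u(3)
    show ?case by (simp only: power_Suc2[of _ "Suc k"] v_mult[OF u(1)] v_mult[OF u(2)] less_imp_le)
  qed (use u in simp)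
  obtain k where "n = Suc k" using \<open>n > 0\<close> gr0_implies_Suc by blast
  thus ?thesis
    using strict[OF v, of x y k] strict[OF v(2,1), of y x k] eq False by (metis less_irrefl linorder_neqE)
qed

lemma valuation_mult_cancel:
  assumes v: "valuation v" "valuation v'" and eq: "v (x * z) = v' (y * t)" "v z = v' t" and "z \<noteq> 0"
  shows "v x = v' y"
proof -
  have "v z \<noteq> Infty" using v_eq_Infty[OF v(1)] \<open>z \<noteq> 0\<close> by blast
  moreover have "v x + v z = v' y + v z" using eq by (simp add: v_mult[OF v(1)] v_mult[OF v(2)])
  ultimately show ?thesis by (simp add: with_infty_add_left_cancel)
qed

text \<open>
  Induction step: if \<open>p\<close> or \<open>r\<close> separates \<open>x\<close> from \<open>y\<close>, then \<open>p\<^sup>t r\<close> does so for all but at most one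
  \<open>t > 0\<close>, because the value group is torsion-free.
\<close>
lemma separating_polynomial:
  assumes R: "pair_ring R" and v: "valuation v" "valuation v'" and "finite Y"
    and sep: "\<And>y. y \<in> Y \<Longrightarrow> \<exists>(p, q)\<in>poly_pairs R. poly p x \<noteq> 0 \<and> v (poly p x) \<noteq> v' (poly q y)"
  shows "\<exists>(p, q)\<in>poly_pairs R. poly p x \<noteq> 0 \<and> (\<forall>y\<in>Y. v (poly p x) \<noteq> v' (poly q y))"
  using \<open>finite Y\<close> sep
proof (induction Y)
  case empty
  show ?case using pair_ring_one[OF pair_ring_poly_pairs[OF R]] by force
next
  case (insert y0 Y)
  note pp = pair_ring_poly_pairs[OF R]
  obtain p q where pq: "(p, q) \<in> poly_pairs R" "poly p x \<noteq> 0"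
    "\<And>y. y \<in> Y \<Longrightarrow> v (poly p x) \<noteq> v' (poly q y)" using insert by blast
  obtain r s where rs: "(r, s) \<in> poly_pairs R" "poly r x \<noteq> 0"
    "v (poly r x) \<noteq> v' (poly s y0)" using insert.prems by blast
  \<comment> \<open>The exponents for which the combined pair fails to separate \<open>x\<close>
    from \<open>y\<close>.\<close>
  define B where "B = (\<lambda>y. {t. t > 0 \<and> v (poly (p ^ t * r) x) = v' (poly (q ^ t * s) y)})"
  have unique: "\<not> t1 < t2" if "y \<in> insert y0 Y" "t1 \<in> B y" "t2 \<in> B y" for y t1 t2
  proof
    assume "t1 < t2"
    then obtain d where t2: "t2 = d + t1" "d > 0" by (metis add.commute less_imp_add_positive)
    have 1: "v (poly p x ^ t1 * poly r x) = v' (poly q y ^ t1 * poly s y)"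
      "v (poly p x ^ d * (poly p x ^ t1 * poly r x)) = v' (poly q y ^ d * (poly q y ^ t1 * poly s y))"
      using that by (auto simp: B_def t2 power_add mult.assoc)
    \<comment> \<open>Two bad exponents give, after cancelling, equal values for \<open>p\<close>
      and then for \<open>r\<close> as well; but one of the two separates \<open>x\<close> from
      \<open>y\<close>.\<close>
    have "v (poly p x ^ d) = v' (poly q y ^ d)"
      by (rule valuation_mult_cancel[OF v 1(2,1)]) (use pq rs in auto)
    hence p: "v (poly p x) = v' (poly q y)" by (rule valuation_power_eqD[OF v t2(2)])
    have "v (poly p x ^ t1) = v' (poly q y ^ t1)"
      by (induction t1) (auto simp: v_one[OF v(1)] v_one[OF v(2)] v_mult[OF v(1)] v_mult[OF v(2)] p)
    hence "v (poly r x) = v' (poly s y)"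
      using valuation_mult_cancel[OF v] 1(1) pq(2) by (metis mult.commute power_not_zero)
    thus False using p pq(3) rs(3) that(1) by auto
  qed
  have "finite (B y)" if "y \<in> insert y0 Y" for y
  proof (cases "B y = {}")
    case False
    then obtain t where "t \<in> B y" by blast
    hence "B y \<subseteq> {t}" using unique[OF that] by (metis linorder_neqE_nat singletonI subsetI)
    thus ?thesis by (rule finite_subset) simp
  qed simp
  hence "finite (\<Union>y\<in>insert y0 Y. B y)" using insert.hyps by blast
  moreover have "infinite {0::nat<..}" by (rule infinite_Ioi)
  ultimately obtain t where t: "t > 0" "t \<notin> (\<Union>y\<in>insert y0 Y. B y)"
    by (metis finite_subset greaterThan_iff subsetI)
  have "(p ^ t * r, q ^ t * s) \<in> poly_pairs R"
    by (intro pair_ring_mult[OF pp] pair_ring_power[OF pp] pq rs)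
  thus ?case
    by (rule rev_bexI) (use pq rs t in \<open>auto simp: B_def\<close>)
qed

text \<open>L(X) is not algebraically closed, so minimal polynomials there must inherit their
  splitting from a multiple. Linear factors are peeled off: a root of \<open>p\<close> cancels on
  both sides, any other factor goes to the cofactor.\<close>

lemma dvd_prod_linear:
  fixes p :: "'a::field poly"
  assumes "p dvd (\<Prod>x\<leftarrow>xs. [:- x, 1:])" "lead_coeff p = 1"
  shows "\<exists>ys. p = (\<Prod>y\<leftarrow>ys. [:- y, 1:]) \<and> set ys \<subseteq> set xs"
  using assms
proof (induction xs arbitrary: p)
  case Nil
  hence "is_unit p" by simp
  then obtain c where "p = [:c:]" unfolding is_unit_poly_iff by blast
  hence "p = 1" using Nil.prems(2) by simp
  thus ?case by (intro exI[of _ "[]"]) auto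
next
  case (Cons x xs)
  show ?case
  proof (cases "poly p x = 0")
    case True
    then obtain q where q: "p = [:- x, 1:] * q" by (metis poly_eq_0_iff_dvd dvdE)
    have "q dvd (\<Prod>x\<leftarrow>xs. [:- x, 1:])"
      using Cons.prems(1) unfolding q list.map prod_list.Cons by (rule dvd_mult_cancel_left[THEN iffD1, THEN disjE]) auto
    moreover have "lead_coeff q = 1" using Cons.prems(2) unfolding q lead_coeff_mult by simp
    ultimately obtain ys where "q = (\<Prod>y\<leftarrow>ys. [:- y, 1:])" "set ys \<subseteq> set xs"
      using Cons.IH by blast
    thus ?thesis by (intro exI[of _ "x # ys"]) (auto simp: q)
  next
    case False
    obtain s where s: "[:- x, 1:] * (\<Prod>x\<leftarrow>xs. [:- x, 1:]) = p * s"
      using Cons.prems(1) unfolding list.map prod_list.Cons by blast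
    have "poly p x * poly s x = 0" by (simp flip: poly_mult s)
    hence "[:- x, 1:] dvd s" using False by (simp add: poly_eq_0_iff_dvd)
    then obtain u where "s = [:- x, 1:] * u" by blast
    hence "[:- x, 1:] * (\<Prod>x\<leftarrow>xs. [:- x, 1:]) = [:- x, 1:] * (p * u)"
      unfolding s by (simp only: mult_ac)
    hence "(\<Prod>x\<leftarrow>xs. [:- x, 1:]) = p * u"
      by (subst (asm) mult_cancel_left) auto
    hence "p dvd (\<Prod>x\<leftarrow>xs. [:- x, 1:])" by simp
    from Cons.IH[OF this Cons.prems(2)] show ?thesis by auto
  qed
qed

section \<open>Finding an image for a root\<close>

definition pair_field :: "('a::field \<times> 'b::field) set \<Rightarrow> bool" where
  "pair_field R \<longleftrightarrow> pair_ring R \<and> (\<forall>(x, y)\<in>R. (inverse x, inverse y) \<in> R)"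

text \<open>Zero is the only element of infinite value. Applied to differences, this makes an
  isometric ring of pairs the graph of an injective map.\<close>

lemma isometric_eq_0_iff:
  assumes "valuation w" "valuation w'" "isometric w w' R" "(x, y) \<in> R"
  shows "x = 0 \<longleftrightarrow> y = 0"
  using isometricD[OF assms(3,4)] by (simp flip: v_eq_Infty[OF assms(1)] v_eq_Infty[OF assms(2)])

text \<open>The hypothesis \<open>zero\<close>, that each \<open>y\<close> inherits the relations of
  \<open>x\<close>, is what minimal polynomials supply. It makes every separating pair nonzero at
  \<open>x\<close>, as \<open>separating_polynomial\<close> demands.\<close>

lemma isometric_root:
  assumes R: "pair_ring R" and w: "valuation w" "valuation w'" "isometric w w' R"
    and len: "length xs = length ys"
    and xy: "((\<Prod>x\<leftarrow>xs. [:- x, 1:]), (\<Prod>y\<leftarrow>ys. [:- y, 1:])) \<in> poly_pairs R"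
    and x: "x \<in> set xs"
    and zero: "\<And>p q y. (p, q) \<in> poly_pairs R \<Longrightarrow> poly p x = 0 \<Longrightarrow> y \<in> set ys \<Longrightarrow> poly q y = 0"
  shows "\<exists>y\<in>set ys. \<forall>p q. (p, q) \<in> poly_pairs R \<longrightarrow> w (poly p x) = w' (poly q y)"
proof (rule ccontr)
  assume not: "\<not> ?thesis"
  have "\<exists>(p, q)\<in>poly_pairs R. poly p x \<noteq> 0 \<and> w (poly p x) \<noteq> w' (poly q y)" if y: "y \<in> set ys" for y
  proof -
    obtain p q where pq: "(p, q) \<in> poly_pairs R" "w (poly p x) \<noteq> w' (poly q y)" using not y by blast
    have "poly p x \<noteq> 0"
      using zero[OF pq(1) _ y] pq(2) by (auto simp: v_zero[OF w(1)] v_zero[OF w(2)])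
    thus ?thesis using pq by blast
  qed
  from separating_polynomial[OF R w(1,2) finite_set this]
  obtain p q where pq: "(p, q) \<in> poly_pairs R" "poly p x \<noteq> 0"
    "\<And>y. y \<in> set ys \<Longrightarrow> w (poly p x) \<noteq> w' (poly q y)" by blast
  let ?F = "\<Prod>x\<leftarrow>xs. [:- poly p x, 1:]" and ?G = "\<Prod>y\<leftarrow>ys. [:- poly q y, 1:]"
  have FG: "(?F, ?G) \<in> poly_pairs R"
    by (rule poly_pairs_prod_linear_values[OF R len xy pq(1)])
  have "(\<Sum>u\<leftarrow>map (\<lambda>x. w (poly p x)) xs. min (Val \<gamma>) u) = (\<Sum>u\<leftarrow>map (\<lambda>y. w' (poly q y)) ys. min (Val \<gamma>) u)" for \<gamma>
    using gauss_valuation_poly_pairs[OF w FG, of \<gamma>]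
      gauss_valuation_prod_linear[OF w(1), of 0 \<gamma> 1 "map (poly p) xs"]
      gauss_valuation_prod_linear[OF w(2), of 0 \<gamma> 1 "map (poly q) ys"]
    by (simp add: o_def v_minus[OF w(1)] v_minus[OF w(2)] v_one[OF w(1)] v_one[OF w(2)])
  note attained = Val_in_set_if_sum_min_eq[OF this]
  obtain a where a: "w (poly p x) = Val a"
    using pq(2) by (cases "w (poly p x)") (auto simp: v_eq_Infty[OF w(1)])
  have a_in: "Val a \<in> set (map (\<lambda>x. w (poly p x)) xs)" unfolding a[symmetric] using x by simp
  show False
  proof (cases "\<exists>y\<in>set ys. poly q y \<noteq> 0")
    case True
    then obtain y where y: "y \<in> set ys" "poly q y \<noteq> 0" by blast
    obtain b where b: "w' (poly q y) = Val b"
      using y(2) by (cases "w' (poly q y)") (auto simp: v_eq_Infty[OF w(2)])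
    have "Val b \<in> set (map (\<lambda>y. w' (poly q y)) ys)" unfolding b[symmetric] using y(1) by simp
    from attained[OF a_in this] obtain z where "z \<in> set ys" "Val a = w' (poly q z)" by auto
    thus False using a pq(3) by simp
  next
    case False
    \<comment> \<open>No finite value is available on the right. Here \<open>?G\<close> is a power
      of T, and \<open>R\<close> relates zero only to zero, so \<open>?F\<close> is the same power
      and p(x) = 0.\<close>
    hence "map (\<lambda>y. [:- poly q y, 1:]) ys = map (\<lambda>_. [:0, 1:]) ys" by simp
    hence "map (\<lambda>y. [:- poly q y, 1:]) ys = replicate (length ys) [:0, 1:]"
      by (simp only: map_replicate_const)
    hence G: "?G = monom 1 (length ys)"
      by (simp add: monom_altdef)
    have "coeff ?F i = coeff (monom 1 (length xs)) i" for i
    proof (cases "i = length xs")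
      case True
      thus ?thesis using degree_prod_list_linear[of "map (poly p) xs"] by (simp add: o_def)
    next
      case False
      have "(coeff ?F i, coeff (monom 1 (length ys)) i) \<in> R"
        using FG[unfolded G] unfolding poly_pairs_def by blast
      from isometric_eq_0_iff[OF w this] False len show ?thesis by simp
    qed
    hence "?F = monom 1 (length xs)" by (rule poly_eqI)
    moreover have "poly ?F (poly p x) = 0"
      using x by (force simp: poly_prod_list prod_list_zero_iff)
    ultimately show False using pq(2) by (simp add: poly_monom)
  qed
qed

section \<open>Extending an isometry\<close>

lemma poly_prod_list_linear_eq_0_iff:
  "poly (\<Prod>x\<leftarrow>xs. [:- x, 1:]) z = 0 \<longleftrightarrow> z \<in> set (xs :: 'a::idom list)"
  by (induction xs) auto

lemma isometric_poly_pairs_degree: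
  assumes "valuation w" "valuation w'" "isometric w w' R" "(p, q) \<in> poly_pairs R"
  shows "degree p = degree q"
proof -
  have "coeff p i = 0 \<longleftrightarrow> coeff q i = 0" for i
    using isometric_eq_0_iff[OF assms(1-3)] assms(4) by (auto simp: poly_pairs_def)
  hence "degree p \<le> degree q" "degree q \<le> degree p" by (metis coeff_eq_0 degree_le)+
  thus ?thesis by simp
qed

text \<open>A pair of least degree annihilating \<open>x\<close> is made monic by inverses in
  \<open>R\<close>. Division in pairs then leaves remainder zero on the left by minimality and on
  the right by isometry, so relations of \<open>x\<close> pass to the roots of
  \<open>m'\<close>.\<close>

lemma minimal_polynomial_pair:
  assumes R: "pair_field R" and w: "valuation w" "valuation w'" "isometric w w' R"
    and fg: "(f, g) \<in> poly_pairs R" "f \<noteq> 0" "poly f x = 0"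
  obtains m m' where "(m, m') \<in> poly_pairs R" "poly m x = 0" "lead_coeff m = 1" "lead_coeff m' = 1"
    "\<And>p q. (p, q) \<in> poly_pairs R \<Longrightarrow> poly p x = 0 \<Longrightarrow> m dvd p \<and> m' dvd q"
proof -
  have ring: "pair_ring R" using R by (simp add: pair_field_def)
  note deg = isometric_poly_pairs_degree[OF w]
  obtain k k' where k: "(k, k') \<in> poly_pairs R" "k \<noteq> 0" "poly k x = 0"
    and min: "\<And>p q. (p, q) \<in> poly_pairs R \<Longrightarrow> p \<noteq> 0 \<Longrightarrow> poly p x = 0 \<Longrightarrow> degree k \<le> degree p"
  proof -
    let ?P = "\<lambda>u. u \<in> poly_pairs R \<and> fst u \<noteq> 0 \<and> poly (fst u) x = 0"
    have "?P (f, g)" using fg by simp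
    from ex_has_least_nat[of ?P, OF this, of "\<lambda>u. degree (fst u)"]
    obtain u where "?P u" "\<And>v. ?P v \<Longrightarrow> degree (fst u) \<le> degree (fst v)" by blast
    thus thesis by (intro that[of "fst u" "snd u"]) auto
  qed
  define c c' where "c = lead_coeff k" and "c' = lead_coeff k'"
  have c: "(c, c') \<in> R" using k(1) deg[OF k(1)] by (simp add: c_def c'_def poly_pairs_def)
  have "c \<noteq> 0" using k(2) by (simp add: c_def)
  hence "c' \<noteq> 0" using isometric_eq_0_iff[OF w c] by simp
  define m m' where "m = [:inverse c:] * k" and "m' = [:inverse c':] * k'"
  have m: "(m, m') \<in> poly_pairs R" unfolding m_def m'_def
    using R c by (intro pair_ring_mult[OF pair_ring_poly_pairs[OF ring]] k poly_pairs_const[OF ring])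
      (auto simp: pair_field_def)
  have m_simps: "poly m x = 0" "lead_coeff m = 1" "lead_coeff m' = 1" "degree m = degree k"
    using k \<open>c \<noteq> 0\<close> \<open>c' \<noteq> 0\<close> by (auto simp: m_def m'_def c_def c'_def)
  have "m dvd p \<and> m' dvd q" if pq: "(p, q) \<in> poly_pairs R" "poly p x = 0" for p q
  proof -
    obtain s t r u where div: "(r, u) \<in> poly_pairs R" "p = m * s + r" "q = m' * t + u"
      "\<And>i. i \<ge> degree m \<Longrightarrow> coeff r i = 0 \<and> coeff u i = 0"
      by (rule poly_pairs_division[OF ring m m_simps(2,3) refl deg[OF m, symmetric] pq(1)]) blast
    have "r = 0"
    proof (rule ccontr)
      assume "r \<noteq> 0"
      hence "degree r < degree m" using div(4)[of "degree r"] by (auto simp: not_le[symmetric])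
      moreover have "poly r x = 0" using pq(2) m_simps(1) by (simp add: div(2))
      ultimately show False using min[OF div(1) \<open>r \<noteq> 0\<close>] m_simps(4) by simp
    qed
    moreover from this have "u = 0"
      using div(1) isometric_eq_0_iff[OF w] by (auto simp: poly_pairs_def poly_eq_iff)
    ultimately show ?thesis using div(2,3) by simp
  qed
  thus thesis using that m m_simps by blast
qed

text \<open>The minimal pair divides the two given products, so both members split and, having equal
  degree, fit \<open>isometric_root\<close>.\<close>

lemma isometric_root_exists:
  assumes R: "pair_field R" and w: "valuation w" "valuation w'" "isometric w w' R"
    and xy: "((\<Prod>x\<leftarrow>xs. [:- x, 1:]), (\<Prod>y\<leftarrow>ys. [:- y, 1:])) \<in> poly_pairs R" and x: "x \<in> set xs"
  shows "\<exists>y. \<forall>p q. (p, q) \<in> poly_pairs R \<longrightarrow> w (poly p x) = w' (poly q y)"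
proof -
  let ?f = "\<Prod>x\<leftarrow>xs. [:- x, 1:]"
  have ring: "pair_ring R" using R by (simp add: pair_field_def)
  have f: "?f \<noteq> 0" "poly ?f x = 0"
    using degree_prod_list_linear(2)[of xs] x unfolding poly_prod_list_linear_eq_0_iff by auto
  obtain m m' where m: "(m, m') \<in> poly_pairs R" "poly m x = 0" "lead_coeff m = 1" "lead_coeff m' = 1"
    and m_dvd: "\<And>p q. (p, q) \<in> poly_pairs R \<Longrightarrow> poly p x = 0 \<Longrightarrow> m dvd p \<and> m' dvd q"
    using minimal_polynomial_pair[OF R w xy f] by metis
  obtain us where us: "m = (\<Prod>x\<leftarrow>us. [:- x, 1:])"
    using dvd_prod_linear m(3) m_dvd[OF xy f(2)] by blast
  obtain vs where vs: "m' = (\<Prod>x\<leftarrow>vs. [:- x, 1:])"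
    using dvd_prod_linear m(4) m_dvd[OF xy f(2)] by blast
  have "length us = length vs"
    using isometric_poly_pairs_degree[OF w m(1)] unfolding us vs by (simp only: degree_prod_list_linear)
  moreover have "x \<in> set us" using m(2) unfolding us poly_prod_list_linear_eq_0_iff .
  moreover have "poly q y = 0" if "(p, q) \<in> poly_pairs R" "poly p x = 0" "y \<in> set vs" for p q y
  proof -
    have "poly m' y = 0" using that(3) unfolding vs poly_prod_list_linear_eq_0_iff .
    thus ?thesis using m_dvd[OF that(1,2)] by (auto simp: dvd_def)
  qed
  ultimately show ?thesis
    using isometric_root[OF ring w _ m(1)[unfolded us vs]] by blast
qed

text \<open>Equal values of corresponding polynomials at \<open>x\<close> and \<open>y\<close> serve
  twice: they carry zeros to zeros, so that quotients correspond, and they make the extension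
  isometric.\<close>

lemma extend_isometric_pair_field:
  assumes R: "pair_field R" and w: "valuation w" "valuation w'" "isometric w w' R"
    and xy: "((\<Prod>x\<leftarrow>xs. [:- x, 1:]), (\<Prod>y\<leftarrow>ys. [:- y, 1:])) \<in> poly_pairs R" and x: "x \<in> set xs"
  shows "\<exists>S. R \<subseteq> S \<and> pair_field S \<and> isometric w w' S \<and> x \<in> Domain S"
proof -
  have ring: "pair_ring R" using R by (simp add: pair_field_def)
  note pp = pair_ring_poly_pairs[OF ring]
  obtain y where y: "\<And>p q. (p, q) \<in> poly_pairs R \<Longrightarrow> w (poly p x) = w' (poly q y)"
    using isometric_root_exists[OF assms] by blast
  have zero: "poly p x = 0 \<longleftrightarrow> poly q y = 0" if "(p, q) \<in> poly_pairs R" for p q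
    using y[OF that] by (simp flip: v_eq_Infty[OF w(1)] v_eq_Infty[OF w(2)])
  \<comment> \<open>Generated by \<open>R\<close> and the pair (x, y); \<open>zero\<close> keeps the
    second denominator nonzero too.\<close>
  define S where "S = {(poly p x / poly s x, poly q y / poly t y) | p q s t.
    (p, q) \<in> poly_pairs R \<and> (s, t) \<in> poly_pairs R \<and> poly s x \<noteq> 0}"
  have SI: "(poly p x / poly s x, poly q y / poly t y) \<in> S"
    if "(p, q) \<in> poly_pairs R" "(s, t) \<in> poly_pairs R" "poly s x \<noteq> 0" for p q s t
    using that unfolding S_def by blast
  have SE: "\<exists>p q s t. (p, q) \<in> poly_pairs R \<and> (s, t) \<in> poly_pairs R \<and> poly s x \<noteq> 0 \<and> poly t y \<noteq> 0 \<and>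
      a = poly p x / poly s x \<and> b = poly q y / poly t y" if "(a, b) \<in> S" for a b
    using that zero unfolding S_def by blast
  have S_poly: "(poly p x, poly q y) \<in> S" if "(p, q) \<in> poly_pairs R" for p q
    using SI[OF that pair_ring_one[OF pp]] by simp
  have "R \<subseteq> S"
    using S_poly[OF poly_pairs_const[OF ring]] by auto
  moreover have "x \<in> Domain S"
    using S_poly[OF poly_pairs_X[OF ring]] by auto
  moreover have "isometric w w' S"
    unfolding isometric_def
  proof clarify
    fix a b assume "(a, b) \<in> S"
    from SE[OF this] obtain p q s t where *: "(p, q) \<in> poly_pairs R" "(s, t) \<in> poly_pairs R"
      "poly s x \<noteq> 0" "poly t y \<noteq> 0" "a = poly p x / poly s x" "b = poly q y / poly t y" by blast
    hence "w (a * poly s x) = w' (b * poly t y)" using y by simp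
    thus "w a = w' b" by (rule valuation_mult_cancel[OF w(1,2)]) (use y * in auto)
  qed
  moreover have "pair_field S"
    unfolding pair_field_def pair_ring_def
  proof (intro conjI allI impI ballI)
    show "(1, 1) \<in> S" using S_poly[OF pair_ring_one[OF pp]] by simp
  next
    fix a b c d assume "(a, b) \<in> S" "(c, d) \<in> S"
    obtain p q s t where 1: "(p, q) \<in> poly_pairs R" "(s, t) \<in> poly_pairs R"
      "poly s x \<noteq> 0" "poly t y \<noteq> 0" "a = poly p x / poly s x" "b = poly q y / poly t y"
      using SE[OF \<open>(a, b) \<in> S\<close>] by blast
    obtain p' q' s' t' where 2: "(p', q') \<in> poly_pairs R" "(s', t') \<in> poly_pairs R"
      "poly s' x \<noteq> 0" "poly t' y \<noteq> 0" "c = poly p' x / poly s' x" "d = poly q' y / poly t' y"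
      using SE[OF \<open>(c, d) \<in> S\<close>] by blast
    have "(poly (p * s' - p' * s) x / poly (s * s') x, poly (q * t' - q' * t) y / poly (t * t') y) \<in> S"
      by (intro SI pair_ring_diff[OF pp] pair_ring_mult[OF pp]) (use 1 2 in auto)
    thus "(a - c, b - d) \<in> S" using 1 2 by (simp add: diff_frac_eq)
    have "(poly (p * p') x / poly (s * s') x, poly (q * q') y / poly (t * t') y) \<in> S"
      by (intro SI pair_ring_mult[OF pp]) (use 1 2 in auto)
    thus "(a * c, b * d) \<in> S" using 1 2 by simp
  next
    fix z assume "z \<in> S"
    obtain a b where z: "z = (a, b)" by (cases z)
    obtain p q s t where 1: "(p, q) \<in> poly_pairs R" "(s, t) \<in> poly_pairs R"
      "poly s x \<noteq> 0" "poly t y \<noteq> 0" "a = poly p x / poly s x" "b = poly q y / poly t y"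
      using SE[OF \<open>z \<in> S\<close>[unfolded z]] by blast
    have "(inverse (poly p x / poly s x), inverse (poly q y / poly t y)) \<in> S"
    proof (cases "poly p x = 0")
      case True
      thus ?thesis using zero[OF 1(1)] S_poly[OF pair_ring_zero[OF pp]] by simp
    next
      case False
      show ?thesis using SI[OF 1(2,1) False] by simp
    qed
    thus "case z of (a, b) \<Rightarrow> (inverse a, inverse b) \<in> S" using 1(5,6) z by simp
  qed
  ultimately show ?thesis by blast
qed

section \<open>Reversing and maximally extending isometric pair fields\<close>

lemma pair_field_converse: "pair_field R \<Longrightarrow> pair_field (R\<inverse>)"
  by (auto simp: pair_field_def pair_ring_def)

lemma isometric_converse: "isometric w w' R \<Longrightarrow> isometric w' w (R\<inverse>)"
  by (auto simp: isometric_def)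

lemma poly_pairs_converse: "poly_pairs (R\<inverse>) = (poly_pairs R)\<inverse>"
  by (auto simp: poly_pairs_def)

text \<open>The axioms involve at most two pairs at a time, and any two pairs lie in a common member
  of the chain.\<close>

lemma pair_field_Union_chain:
  assumes "C \<noteq> {}" "subset.chain {S. pair_field S} C"
  shows "pair_field (\<Union>C)"
proof -
  have C: "pair_field S" if "S \<in> C" for S using assms(2) that by (auto simp: subset.chain_def)
  have common: "\<exists>S\<in>C. z \<in> S \<and> z' \<in> S" if z: "z \<in> \<Union>C" "z' \<in> \<Union>C" for z z'
  proof -
    obtain S S' where "z \<in> S" "S \<in> C" "z' \<in> S'" "S' \<in> C" using z by blast
    moreover from this have "S \<subseteq> S' \<or> S' \<subseteq> S" using assms(2) by (auto simp: subset.chain_def)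
    ultimately show ?thesis by blast
  qed
  show ?thesis
    unfolding pair_field_def pair_ring_def
  proof (intro conjI allI impI ballI)
    show "(1, 1) \<in> \<Union>C" using assms(1) C by (auto simp: pair_field_def pair_ring_def)
  next
    fix x y u v assume "(x, y) \<in> \<Union>C" "(u, v) \<in> \<Union>C"
    then obtain S where S: "S \<in> C" "(x, y) \<in> S" "(u, v) \<in> S" using common by blast
    hence "(x - u, y - v) \<in> S" "(x * u, y * v) \<in> S"
      using C[OF S(1)] by (auto simp: pair_field_def pair_ring_def)
    thus "(x - u, y - v) \<in> \<Union>C" "(x * u, y * v) \<in> \<Union>C" using S(1) by blast+
  next
    fix z assume "z \<in> \<Union>C"
    thus "case z of (x, y) \<Rightarrow> (inverse x, inverse y) \<in> \<Union>C"
      using C by (fastforce simp: pair_field_def)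
  qed
qed

lemma maximal_isometric_pair_field:
  assumes "pair_field R0" "isometric w w' R0"
  obtains R where "R0 \<subseteq> R" "pair_field R" "isometric w w' R"
    "\<And>S. R \<subseteq> S \<Longrightarrow> pair_field S \<Longrightarrow> isometric w w' S \<Longrightarrow> S = R"
proof -
  let ?A = "{S. R0 \<subseteq> S \<and> pair_field S \<and> isometric w w' S}"
  have "\<exists>M\<in>?A. \<forall>X\<in>?A. M \<subseteq> X \<longrightarrow> X = M"
  proof (rule subset_Zorn_nonempty)
    show "?A \<noteq> {}" using assms by blast
  next
    fix C assume C: "C \<noteq> {}" "subset.chain ?A C"
    hence sub: "C \<subseteq> ?A" and "subset.chain {S. pair_field S} C" by (auto simp: subset.chain_def)
    hence "pair_field (\<Union>C)" using pair_field_Union_chain C(1) by blast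
    moreover have "R0 \<subseteq> \<Union>C" using sub C(1) by blast
    moreover have "isometric w w' (\<Union>C)" using sub by (fastforce simp: isometric_def)
    ultimately show "\<Union>C \<in> ?A" by blast
  qed
  then obtain R where R: "R \<in> ?A" "\<forall>X\<in>?A. R \<subseteq> X \<longrightarrow> X = R" by blast
  show thesis
    by (rule that[of R]) (use R in auto)
qed

section \<open>Changing the centre of a Gauss valuation\<close>

lemma alg_closed_imp_factorization_list:
  fixes p :: "'a::alg_closed_field poly"
  obtains xs where "p = smult (lead_coeff p) (\<Prod>x\<leftarrow>xs. [:- x, 1:])"
proof (cases "p = 0")
  case True
  thus thesis using that[of "[]"] by simp
next
  case False
  then obtain A where A: "p = smult (lead_coeff p) (\<Prod>x\<in>#A. [:- x, 1:])"
    using alg_closed_imp_factorization by blast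
  obtain xs where "A = mset xs" using ex_mset by metis
  hence "(\<Prod>x\<in>#A. [:- x, 1:]) = (\<Prod>x\<leftarrow>xs. [:- x, 1:])"
    by (simp flip: prod_mset_prod_list)
  thus thesis using A that by simp
qed

text \<open>Every point of a closed ball is a centre of it: the ultrametric inequality gives
  \<open>min_eq\<close>, and over an algebraically closed field the values on linear polynomials and
  constants determine the valuation.\<close>

lemma gauss_valuation_eqI:
  fixes v :: "'l::alg_closed_field \<Rightarrow> 'g::linordered_ab_group_add with_infty"
  assumes v: "valuation v" and ac: "Val \<gamma> \<le> v (a - c)"
  shows "gauss_valuation v a \<gamma> = gauss_valuation v c \<gamma>"
proof -
  have le: "min (Val \<gamma>) (v (y - z)) \<le> min (Val \<gamma>) (v (x - z))" if "Val \<gamma> \<le> v (x - y)" for x y z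
  proof (rule min.boundedI)
    have "min (Val \<gamma>) (v (y - z)) \<le> min (v (x - y)) (v (y - z))" by (rule min.mono[OF that order_refl])
    also have "\<dots> \<le> v (x - z)" using v_add[OF v, of "x - y" "y - z"] by simp
    finally show "min (Val \<gamma>) (v (y - z)) \<le> v (x - z)" .
  qed simp
  have "Val \<gamma> \<le> v (c - a)" using ac v_minus[OF v, of "a - c"] by simp
  hence min_eq: "min (Val \<gamma>) (v (a - z)) = min (Val \<gamma>) (v (c - z))" for z
    using le[OF ac] le by (intro antisym) auto
  have poly: "gauss_valuation v a \<gamma> (to_fract p) = gauss_valuation v c \<gamma> (to_fract p)" for p
  proof -
    obtain k xs where p: "p = smult k (\<Prod>x\<leftarrow>xs. [:- x, 1:])"
      using alg_closed_imp_factorization_list[of p] by blast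
    show ?thesis unfolding p gauss_valuation_prod_linear[OF v] min_eq ..
  qed
  show ?thesis
  proof
    fix f :: "'l poly fract"
    obtain p q where f: "f = Fract p q" "q \<noteq> 0" by (cases f) auto
    have *: "f * to_fract q = to_fract p" using f by (simp add: to_fract_def eq_fract)
    show "gauss_valuation v a \<gamma> f = gauss_valuation v c \<gamma> f"
      by (rule valuation_mult_cancel[OF valuation_gauss_valuation[OF v] valuation_gauss_valuation[OF v],
          where z = "to_fract q" and t = "to_fract q"])
        (use f(2) in \<open>simp_all only: * poly to_fract_hom.hom_0_iff not_False_eq_True\<close>)
  qed
qed

section \<open>The field K(X) and split polynomials over K\<close>

text \<open>The starting point of the extension process: condition (i) says that this pair field is
  isometric for the two Gauss valuations.\<close>

lemma pair_field_Id_on_rational_functions_over: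
  assumes "field_hom \<iota>"
  shows "pair_field (Id_on (rational_functions_over \<iota>))"
proof -
  interpret field_hom \<iota> by fact
  interpret mp: map_poly_inj_idom_hom \<iota> ..
  let ?K = "rational_functions_over \<iota>"
  have KI: "Fract (map_poly \<iota> p) (map_poly \<iota> q) \<in> ?K" if "q \<noteq> 0" for p q
    using that unfolding rational_functions_over_def by blast
  have 1: "1 \<in> ?K" using KI[of 1 1] by (simp add: fract_collapse)
  have diff: "x - y \<in> ?K" if x: "x \<in> ?K" "y \<in> ?K" for x y
  proof -
    obtain p q r s where *: "x = Fract (map_poly \<iota> p) (map_poly \<iota> q)" "q \<noteq> 0"
      "y = Fract (map_poly \<iota> r) (map_poly \<iota> s)" "s \<noteq> 0"
      using x unfolding rational_functions_over_def by blast
    thus ?thesis using KI[of "q * s" "p * s - r * q"] by (simp add: hom_distribs)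
  qed
  have mult: "x * y \<in> ?K" if x: "x \<in> ?K" "y \<in> ?K" for x y
  proof -
    obtain p q r s where *: "x = Fract (map_poly \<iota> p) (map_poly \<iota> q)" "q \<noteq> 0"
      "y = Fract (map_poly \<iota> r) (map_poly \<iota> s)" "s \<noteq> 0"
      using x unfolding rational_functions_over_def by blast
    thus ?thesis using KI[of "q * s" "p * r"] by (simp add: hom_distribs)
  qed
  have inverse: "inverse x \<in> ?K" if x: "x \<in> ?K" for x
  proof -
    obtain p q where *: "x = Fract (map_poly \<iota> p) (map_poly \<iota> q)" "q \<noteq> 0"
      using x unfolding rational_functions_over_def by blast
    show ?thesis
    proof (cases "p = 0")
      case True
      thus ?thesis using diff[OF 1 1] * by (simp add: fract_collapse)
    next
      case False
      thus ?thesis using KI[of p q] * by simp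
    qed
  qed
  show ?thesis unfolding pair_field_def pair_ring_def
    using 1 diff mult inverse by (auto simp: Id_on_def)
qed

lemma to_fract_map_poly_in_rational_functions_over:
  assumes "field_hom \<iota>"
  shows "to_fract (map_poly \<iota> p) \<in> rational_functions_over \<iota>"
proof -
  interpret field_hom \<iota> by fact
  show ?thesis unfolding rational_functions_over_def to_fract_def
    by (intro CollectI exI[of _ p] exI[of _ 1]) simp
qed

text \<open>The leading coefficient is divided out inside K, which leaves a bare product of linear
  factors as \<open>extend_isometric_pair_field\<close> expects.\<close>

lemma algebraic_closure_map_split:
  fixes \<iota> :: "'k::field \<Rightarrow> 'l::alg_closed_field"
  assumes "algebraic_closure_map \<iota>"
  obtains p xs where "map_poly \<iota> p = (\<Prod>x\<leftarrow>xs. [:- x, 1:])" "c \<in> set xs"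
proof -
  interpret field_hom \<iota> using assms by (simp add: algebraic_closure_map_def)
  interpret mp: map_poly_inj_idom_hom \<iota> ..
  obtain p where p: "p \<noteq> 0" "poly (map_poly \<iota> p) c = 0"
    using assms unfolding algebraic_closure_map_def by blast
  have lead: "lead_coeff (map_poly \<iota> p) = \<iota> (lead_coeff p)" by simp
  obtain xs where "map_poly \<iota> p = smult (lead_coeff (map_poly \<iota> p)) (\<Prod>x\<leftarrow>xs. [:- x, 1:])"
    by (rule alg_closed_imp_factorization_list)
  hence xs: "map_poly \<iota> p = smult (\<iota> (lead_coeff p)) (\<Prod>x\<leftarrow>xs. [:- x, 1:])"
    unfolding lead .
  have "map_poly \<iota> (smult (inverse (lead_coeff p)) p) = (\<Prod>x\<leftarrow>xs. [:- x, 1:])"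
    using p(1) by (simp add: hom_distribs xs)
  moreover have "c \<in> set xs"
    using p unfolding xs by (simp add: poly_prod_list_linear_eq_0_iff[simplified])
  ultimately show thesis using that by blast
qed

section \<open>Conjugate Gauss valuations\<close>

text \<open>As \<sigma> fixes polynomials over K, it turns a factorisation into another one of the
  same polynomial, with roots \<sigma>(x); and v(\<sigma>(b) - \<sigma>(x)) = v(b - x).\<close>

lemma gauss_valuation_decomposition_group:
  fixes \<iota> :: "'k::field \<Rightarrow> 'l::alg_closed_field"
    and v :: "'l \<Rightarrow> 'g::linordered_ab_group_add with_infty"
  assumes v: "valuation v" and \<sigma>: "\<sigma> \<in> decomposition_group \<iota> v" and f: "f \<in> rational_functions_over \<iota>"
    and \<iota>: "field_hom \<iota>"
  shows "gauss_valuation v (\<sigma> b) \<gamma> f = gauss_valuation v b \<gamma> f"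
proof -
  interpret \<iota>: field_hom \<iota> by fact
  have "field_hom \<sigma>" and fix_\<iota>: "\<And>c. \<sigma> (\<iota> c) = \<iota> c" and v_\<sigma>: "\<And>c. v (\<sigma> c) = v c"
    using \<sigma> by (auto simp: decomposition_group_def Gal_def)
  interpret \<sigma>: field_hom \<sigma> by fact
  interpret m\<sigma>: map_poly_inj_idom_hom \<sigma> ..
  interpret m\<iota>: map_poly_inj_idom_hom \<iota> ..
  note val = valuation_gauss_valuation[OF v]
  have poly: "gauss_valuation v (\<sigma> b) \<gamma> (to_fract (map_poly \<iota> p)) = gauss_valuation v b \<gamma> (to_fract (map_poly \<iota> p))"
    for p
  proof -
    obtain c xs where xs: "map_poly \<iota> p = smult c (\<Prod>x\<leftarrow>xs. [:- x, 1:])"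
      using alg_closed_imp_factorization_list[of "map_poly \<iota> p"] by blast
    have "map_poly \<iota> p = map_poly \<sigma> (map_poly \<iota> p)"
      by (simp add: map_poly_map_poly fix_\<iota> o_def)
    also have "\<dots> = smult (\<sigma> c) (\<Prod>x\<leftarrow>map \<sigma> xs. [:- x, 1:])"
      unfolding xs by (simp add: hom_distribs m\<sigma>.hom_prod_list o_def)
    finally have "gauss_valuation v (\<sigma> b) \<gamma> (to_fract (map_poly \<iota> p)) =
        v (\<sigma> c) + (\<Sum>x\<leftarrow>map \<sigma> xs. min (Val \<gamma>) (v (\<sigma> b - x)))"
      by (simp only: gauss_valuation_prod_linear[OF v])
    also have "\<dots> = v c + (\<Sum>x\<leftarrow>xs. min (Val \<gamma>) (v (b - x)))"
      by (simp add: o_def v_\<sigma> flip: \<sigma>.hom_minus)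
    finally show ?thesis unfolding xs gauss_valuation_prod_linear[OF v] .
  qed
  obtain p q where f: "f = Fract (map_poly \<iota> p) (map_poly \<iota> q)" "q \<noteq> 0"
    using f unfolding rational_functions_over_def by blast
  have *: "f * to_fract (map_poly \<iota> q) = to_fract (map_poly \<iota> p)" using f by (simp add: to_fract_def eq_fract)
  show ?thesis
    by (rule valuation_mult_cancel[OF val val, where z = "to_fract (map_poly \<iota> q)" and t = "to_fract (map_poly \<iota> q)"])
      (use f(2) in \<open>simp_all only: * poly to_fract_hom.hom_0_iff m\<iota>.hom_0_iff not_False_eq_True\<close>)
qed

text \<open>The conclusion is the bound from which \<open>gauss_valuation_eqI\<close> yields
  condition (ii).\<close>

lemma conjugate_in_decomposition_group:
  fixes \<iota> :: "'k::field \<Rightarrow> 'l::alg_closed_field"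
    and v :: "'l \<Rightarrow> 'g::linordered_ab_group_add with_infty"
  assumes \<iota>: "algebraic_closure_map \<iota>" and v: "valuation v"
    and eq: "\<And>f. f \<in> rational_functions_over \<iota> \<Longrightarrow> gauss_valuation v b \<gamma> f = gauss_valuation v a \<gamma> f"
  shows "\<exists>\<sigma>\<in>decomposition_group \<iota> v. Val \<gamma> \<le> v (a - \<sigma> b)"
proof -
  define w where "w = gauss_valuation v b \<gamma>"
  define w' where "w' = gauss_valuation v a \<gamma>"
  define C :: "'l \<Rightarrow> 'l poly fract" where "C = (\<lambda>c. to_fract [:c:])"
  let ?K = "Id_on (rational_functions_over \<iota>)"
  have hom: "field_hom \<iota>" using \<iota> by (simp add: algebraic_closure_map_def)
  have map_pCons: "map_poly \<iota> (pCons c p) = pCons (\<iota> c) (map_poly \<iota> p)" for c p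
  proof -
    interpret field_hom \<iota> by fact
    show ?thesis by (rule poly_eqI) (simp add: coeff_map_poly coeff_pCons split: nat.split)
  qed
  have w: "valuation w" "valuation w'" unfolding w_def w'_def by (rule valuation_gauss_valuation[OF v])+
  have C_add: "C (x + y) = C x + C y" and C_mult: "C (x * y) = C x * C y" for x y
    unfolding C_def to_fract_hom.hom_add[symmetric] to_fract_hom.hom_mult[symmetric]
    by (rule arg_cong[of _ _ to_fract], simp)+
  have "C 0 = 0" "C 1 = 1" by (simp_all add: C_def)
  note C_hom = this C_add C_mult
  have C_eq: "C x = C y \<longleftrightarrow> x = y" for x y by (simp add: C_def)
  have w_C: "w (C c) = v c" "w' (C c) = v c" for c
    unfolding w_def w'_def C_def by (rule gauss_valuation_const[OF v])+
  have "isometric w w' ?K" using eq by (auto simp: isometric_def w_def w'_def)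
  with pair_field_Id_on_rational_functions_over[OF hom]
  obtain R where R: "?K \<subseteq> R" "pair_field R" "isometric w w' R"
    and max: "\<And>S. R \<subseteq> S \<Longrightarrow> pair_field S \<Longrightarrow> isometric w w' S \<Longrightarrow> S = R"
    using maximal_isometric_pair_field by blast
  have ring: "pair_ring R" using R(2) by (simp add: pair_field_def)
  have \<iota>_K: "C (\<iota> c) \<in> rational_functions_over \<iota>" for c
  proof -
    interpret field_hom \<iota> by fact
    show ?thesis
      using to_fract_map_poly_in_rational_functions_over[OF hom, of "[:c:]"] by (simp add: C_def map_pCons)
  qed
  \<comment> \<open>The coefficients lie in K, where \<open>R\<close> contains the identity, so the
    product is paired with itself.\<close>
  have split: "\<exists>xs. ((\<Prod>x\<leftarrow>map C xs. [:- x, 1:]), (\<Prod>x\<leftarrow>map C xs. [:- x, 1:])) \<in> poly_pairs R \<and> c \<in> set xs" for c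
  proof -
    obtain p xs where p: "map_poly \<iota> p = (\<Prod>x\<leftarrow>xs. [:- x, 1:])" "c \<in> set xs"
      by (rule algebraic_closure_map_split[OF \<iota>])
    interpret C: inj_idom_hom C by unfold_locales (simp_all add: C_hom, simp add: C_def)
    interpret mC: map_poly_inj_idom_hom C ..
    have "(\<Prod>x\<leftarrow>map C xs. [:- x, 1:]) = map_poly C (map_poly \<iota> p)"
      unfolding p by (simp add: hom_distribs mC.hom_prod_list o_def)
    moreover have "coeff (map_poly C (map_poly \<iota> p)) i \<in> rational_functions_over \<iota>" for i
    proof -
      interpret field_hom \<iota> by fact
      show ?thesis using \<iota>_K[of "coeff p i"] by (simp add: coeff_map_poly C_hom)
    qed
    ultimately show ?thesis using R(1) p(2) by (auto simp: poly_pairs_def intro!: exI[of _ xs])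
  qed
  have Domain: "C c \<in> Domain R" for c
  proof -
    obtain xs where "((\<Prod>x\<leftarrow>map C xs. [:- x, 1:]), (\<Prod>x\<leftarrow>map C xs. [:- x, 1:])) \<in> poly_pairs R" "c \<in> set xs"
      using split by blast
    thus ?thesis using extend_isometric_pair_field[OF R(2) w R(3), of "map C xs" "map C xs" "C c"] max by auto
  qed
  have Range: "C c \<in> Range R" for c
  proof -
    obtain xs where xs: "((\<Prod>x\<leftarrow>map C xs. [:- x, 1:]), (\<Prod>x\<leftarrow>map C xs. [:- x, 1:])) \<in> poly_pairs R" "c \<in> set xs"
      using split by blast
    obtain S where S: "R\<inverse> \<subseteq> S" "pair_field S" "isometric w' w S" "C c \<in> Domain S"
      using extend_isometric_pair_field[OF pair_field_converse[OF R(2)] w(2,1) isometric_converse[OF R(3)],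
          of "map C xs" "map C xs" "C c"] xs by (auto simp: poly_pairs_converse)
    \<comment> \<open>Turned back, the extension of the reversed relation contains \<open>R\<close>,
      so maximality applies.\<close>
    have "S\<inverse> = R"
      using S by (intro max pair_field_converse isometric_converse) auto
    thus ?thesis using S(4) by auto
  qed
  have inj: "x = x' \<longleftrightarrow> y = y'" if "(x, y) \<in> R" "(x', y') \<in> R" for x y x' y'
    using isometric_eq_0_iff[OF w R(3) pair_ring_diff[OF ring that]] by simp
  \<comment> \<open>Constants are the elements of L(X) that are roots of these split polynomials, a
    property shared by the two members of a pair.\<close>
  have const: "x \<in> range C \<longleftrightarrow> y \<in> range C" if xy: "(x, y) \<in> R" for x y
  proof -
    have root: "poly (\<Prod>x\<leftarrow>map C xs. [:- x, 1:]) x = 0 \<longleftrightarrow> poly (\<Prod>x\<leftarrow>map C xs. [:- x, 1:]) y = 0"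
      if "((\<Prod>x\<leftarrow>map C xs. [:- x, 1:]), (\<Prod>x\<leftarrow>map C xs. [:- x, 1:])) \<in> poly_pairs R" for xs
      using isometric_eq_0_iff[OF w R(3) pair_ring_poly[OF ring that xy]] .
    thus ?thesis using split unfolding poly_prod_list_linear_eq_0_iff set_map by blast
  qed
  have "\<exists>d. (C c, C d) \<in> R" for c
    using Domain[of c] const by blast
  then obtain \<sigma> where \<sigma>: "\<And>c. (C c, C (\<sigma> c)) \<in> R" by metis
  have \<sigma>_eqI: "\<sigma> c = d" if "(C c, C d) \<in> R" for c d
    using inj[OF \<sigma>[of c] that] C_eq by simp
  have K: "(f, f) \<in> R" if "f \<in> rational_functions_over \<iota>" for f using R(1) that by blast
  have "field_hom \<sigma>"
  proof
    show "\<sigma> 0 = 0" "\<sigma> 1 = 1"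
      using pair_ring_zero[OF ring] pair_ring_one[OF ring] by (auto intro!: \<sigma>_eqI simp: C_hom)
    show "\<sigma> (x + y) = \<sigma> x + \<sigma> y" "\<sigma> (x * y) = \<sigma> x * \<sigma> y" for x y
      using pair_ring_add[OF ring \<sigma> \<sigma>] pair_ring_mult[OF ring \<sigma> \<sigma>] by (auto intro!: \<sigma>_eqI simp: C_hom)
  qed
  moreover have "bij \<sigma>"
  proof (rule bijI)
    show "inj \<sigma>" using inj[OF \<sigma> \<sigma>] by (auto simp: C_eq intro: injI)
    have "d \<in> range \<sigma>" for d
    proof -
      obtain x where "(x, C d) \<in> R" using Range by blast
      moreover from this obtain c where "x = C c" using const by blast
      ultimately show ?thesis using \<sigma>_eqI by blast
    qed
    thus "surj \<sigma>" by blast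
  qed
  moreover have "\<sigma> (\<iota> c) = \<iota> c" for c by (rule \<sigma>_eqI[OF K[OF \<iota>_K]])
  moreover have "v (\<sigma> c) = v c" for c
    using isometricD[OF R(3) \<sigma>[of c]] by (simp add: w_C)
  ultimately have "\<sigma> \<in> decomposition_group \<iota> v"
    by (auto simp: decomposition_group_def Gal_def)
  moreover have "Val \<gamma> \<le> v (a - \<sigma> b)"
  proof -
    have X: "to_fract [:0, 1:] \<in> rational_functions_over \<iota>"
    proof -
      interpret field_hom \<iota> by fact
      show ?thesis
        using to_fract_map_poly_in_rational_functions_over[OF hom, of "[:0, 1:]"] by (simp add: map_pCons)
    qed
    have "to_fract [:- c, 1:] = to_fract [:0, 1:] - C c" for c :: 'l
      by (simp add: C_def flip: to_fract_hom.hom_minus)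
    \<comment> \<open>X lies in K(X), so \<open>R\<close> pairs it with itself.\<close>
    hence "(to_fract [:- b, 1:], to_fract [:- \<sigma> b, 1:]) \<in> R"
      using pair_ring_diff[OF ring K[OF X] \<sigma>[of b]] by simp
    from isometricD[OF R(3) this]
    have "min (Val \<gamma>) (v (b - b)) = min (Val \<gamma>) (v (a - \<sigma> b))"
      by (simp only: w_def w'_def gauss_valuation_linear[OF v])
    thus ?thesis by (simp add: v_zero[OF v] min_def split: if_splits)
  qed
  ultimately show ?thesis by blast
qed

theorem proposition3p1:
  fixes \<iota> :: "'k::field \<Rightarrow> 'l::alg_closed_field"
    and v :: "'k \<Rightarrow> 'g::linordered_ab_group_add with_infty"
    and vbar :: "'l \<Rightarrow> 'g with_infty"
    and a b :: 'l and \<gamma> :: 'g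
  assumes "valuation v"
    and "algebraic_closure_map \<iota>"
    and "valuation vbar"
    and "\<forall>c. vbar (\<iota> c) = v c"
  shows "restrict (gauss_valuation vbar a \<gamma>) (rational_functions_over \<iota>) =
           restrict (gauss_valuation vbar b \<gamma>) (rational_functions_over \<iota>) \<longleftrightarrow>
         (\<exists>\<sigma>\<in>decomposition_group \<iota> vbar.
            gauss_valuation vbar a \<gamma> = gauss_valuation vbar (\<sigma> b) \<gamma>)"
proof
  assume eq: "restrict (gauss_valuation vbar a \<gamma>) (rational_functions_over \<iota>) =
    restrict (gauss_valuation vbar b \<gamma>) (rational_functions_over \<iota>)"
  \<comment> \<open>The sides are exchanged because \<sigma> is to carry the valuation centred at
    \<open>b\<close> to the one centred at \<open>a\<close>.\<close>
  have "gauss_valuation vbar b \<gamma> f = gauss_valuation vbar a \<gamma> f" if "f \<in> rational_functions_over \<iota>" for f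
    using fun_cong[OF eq, of f] that by simp
  from conjugate_in_decomposition_group[OF assms(2,3) this]
  obtain \<sigma> where "\<sigma> \<in> decomposition_group \<iota> vbar" "Val \<gamma> \<le> vbar (a - \<sigma> b)" by blast
  thus "\<exists>\<sigma>\<in>decomposition_group \<iota> vbar. gauss_valuation vbar a \<gamma> = gauss_valuation vbar (\<sigma> b) \<gamma>"
    using gauss_valuation_eqI[OF assms(3)] by blast
next
  assume "\<exists>\<sigma>\<in>decomposition_group \<iota> vbar. gauss_valuation vbar a \<gamma> = gauss_valuation vbar (\<sigma> b) \<gamma>"
  then obtain \<sigma> where \<sigma>: "\<sigma> \<in> decomposition_group \<iota> vbar"
    "gauss_valuation vbar a \<gamma> = gauss_valuation vbar (\<sigma> b) \<gamma>" by blast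
  have "field_hom \<iota>" using assms(2) by (simp add: algebraic_closure_map_def)
  from gauss_valuation_decomposition_group[OF assms(3) \<sigma>(1) _ this]
  show "restrict (gauss_valuation vbar a \<gamma>) (rational_functions_over \<iota>) =
    restrict (gauss_valuation vbar b \<gamma>) (rational_functions_over \<iota>)"
    unfolding \<sigma>(2) by (intro restrict_ext) blast
qed

end
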